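(* Let $G$ be a locally compact, second countable group and let $G\curvearrowright(X,\zeta)$ be a measure preserving action on a $\sigma$-finite (standard) Borel measure space, with orbit equivalence relation $E=\{(x,gx): x\in X,\ g\in G\}\subseteq X\times X$. Then there exists a Borel family of $G$-invariant, $\sigma$-finite measures $\nu_x$ on $E$, with $\nu_x$ supported on the fiber $p_l^{-1}(x)$, and such that $$\nu=\int_X\nu_x\,d\zeta(x)$$ is a $G$-invariant, $\sigma$-finite measure on $E$.
   Context: $E$ is a Borel subset of $X\times X$ and carries the $G$-action $g(x,y)=(x,gy)$; $G$-invariance of measures on $E$ refers to this action. The map $p_l:E\to X$ is the projection on the left coordinate, $p_l(x,y)=x$. A family $(\nu_x)_{x\in X}$ of Borel measures on $E$ is a Borel family if the map $x\mapsto\nu_x$ is Borel, i.e. $x\mapsto\nu_x(B)$ is Borel for each Borel $B\subseteq E$. *)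

theory Defs
  imports "HOL-Analysis.Analysis"
begin

text \<open>
  The acting group is a type of class \<open>topological_group_add\<close>. Despite the additive notation, this
  class does not assume commutativity: \<open>g + h\<close> is the product \<open>gh\<close> and \<open>0\<close> is the identity.
\<close>

definition standard_borel_space :: "'x measure \<Rightarrow> bool" where
  "standard_borel_space M \<longleftrightarrow>
     (\<exists>T. topspace T = space M \<and> completely_metrizable_space T \<and> second_countable T \<and>
          sets M = sigma_sets (space M) {U. openin T U})"

definition measure_preserving_action ::
    "('g::topological_group_add \<Rightarrow> 'x \<Rightarrow> 'x) \<Rightarrow> 'x measure \<Rightarrow> bool" where
  "measure_preserving_action act M \<longleftrightarrow>
     (\<lambda>(g, x). act g x) \<in> borel \<Otimes>\<^sub>M M \<rightarrow>\<^sub>M M \<and>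
     (\<forall>x\<in>space M. act 0 x = x) \<and>
     (\<forall>g h. \<forall>x\<in>space M. act (g + h) x = act g (act h x)) \<and>
     (\<forall>g. distr M M (act g) = M)"

definition orbit_rel :: "('g \<Rightarrow> 'x \<Rightarrow> 'x) \<Rightarrow> 'x measure \<Rightarrow> ('x \<times> 'x) set" where
  "orbit_rel act M = {(x, act g x) | x g. x \<in> space M}"

text \<open>
  The Borel \<open>\<sigma>\<close>-algebra of the orbit equivalence relation \<open>E\<close>, as the trace of the product
  \<open>\<sigma>\<close>-algebra on \<open>X \<times> X\<close>.
\<close>
definition orbit_sets :: "('g \<Rightarrow> 'x \<Rightarrow> 'x) \<Rightarrow> 'x measure \<Rightarrow> ('x \<times> 'x) set set" where
  "orbit_sets act M = sets (restrict_space (M \<Otimes>\<^sub>M M) (orbit_rel act M))"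

text \<open>Invariance of a measure on \<open>E\<close> under \<open>g(x, y) = (x, gy)\<close>.\<close>
definition right_invariant :: "('g \<Rightarrow> 'x \<Rightarrow> 'x) \<Rightarrow> ('x \<times> 'x) measure \<Rightarrow> bool" where
  "right_invariant act N \<longleftrightarrow> (\<forall>g. distr N N (\<lambda>(x, y). (x, act g y)) = N)"

definition left_fiber :: "('g \<Rightarrow> 'x \<Rightarrow> 'x) \<Rightarrow> 'x measure \<Rightarrow> 'x \<Rightarrow> ('x \<times> 'x) set" where
  "left_fiber act M x = {p \<in> orbit_rel act M. fst p = x}"

definition borel_family ::
    "('g \<Rightarrow> 'x \<Rightarrow> 'x) \<Rightarrow> 'x measure \<Rightarrow> ('x \<Rightarrow> ('x \<times> 'x) measure) \<Rightarrow> bool" where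
  "borel_family act M \<kappa> \<longleftrightarrow>
     (\<forall>x\<in>space M. sets (\<kappa> x) = orbit_sets act M) \<and>
     (\<forall>B\<in>orbit_sets act M. (\<lambda>x. emeasure (\<kappa> x) B) \<in> borel_measurable M)"

text \<open>
  \<open>\<nu> = \<integral> \<kappa> x d\<zeta>(x)\<close>. The library's \<open>bind\<close> does not apply, since the \<open>\<kappa> x\<close> need not be
  subprobability measures.
\<close>
definition is_integral_of_family ::
    "('g \<Rightarrow> 'x \<Rightarrow> 'x) \<Rightarrow> 'x measure \<Rightarrow> ('x \<Rightarrow> ('x \<times> 'x) measure) \<Rightarrow> ('x \<times> 'x) measure \<Rightarrow> bool" where
  "is_integral_of_family act \<zeta> \<kappa> \<nu> \<longleftrightarrow>
     sets \<nu> = orbit_sets act \<zeta> \<and>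
     (\<forall>B\<in>orbit_sets act \<zeta>. emeasure \<nu> B = (\<integral>\<^sup>+ x. emeasure (\<kappa> x) B \<partial>\<zeta>))"

text \<open>
  A family of measures living on the left fibers, each vanishing off \<open>p_l\<^sup>-\<^sup>1(x)\<close>. Almost every
  member must also be nonzero, since otherwise the zero family would qualify; a nonzero member that
  is invariant cannot live on a proper invariant part of its fiber, which is a single \<open>G\<close>-orbit.
  Nonvanishing cannot be asked for every \<open>x\<close>: on a null set of \<open>x\<close> the orbit may carry no nonzero
  invariant \<open>\<sigma>\<close>-finite measure.
\<close>
definition supported_on_left_fibers ::
    "('g \<Rightarrow> 'x \<Rightarrow> 'x) \<Rightarrow> 'x measure \<Rightarrow> ('x \<Rightarrow> ('x \<times> 'x) measure) \<Rightarrow> bool" where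
  "supported_on_left_fibers act \<zeta> \<kappa> \<longleftrightarrow>
     (\<forall>x\<in>space \<zeta>. emeasure (\<kappa> x) (space (\<kappa> x) - left_fiber act \<zeta> x) = 0) \<and>
     (AE x in \<zeta>. emeasure (\<kappa> x) (left_fiber act \<zeta> x) \<noteq> 0)"

end

theory Submission
  imports Defs
begin

text \<open>
  The action need not be free, and a stabiliser may be noncompact, so pushing Haar measure of the
  group to an orbit gives in general a measure that is not \<open>\<sigma>\<close>-finite. What is always
  available is a measure class on each orbit: let \<open>p\<close> be a finite measure on the group whose
  null sets are invariant under right translation, and let \<open>P\<^sub>y\<close> be the law of
  \<open>g y\<close> when \<open>g\<close> is distributed according to \<open>p\<close>. If \<open>z\<close> and
  \<open>y\<close> lie on one orbit, then \<open>P\<^sub>z\<close> and \<open>P\<^sub>y\<close> have the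
  same null sets. Such a \<open>p\<close> is obtained from a right Haar measure, which is constructed in the
  first part by counting translates of small neighbourhoods (\<open>right_haar_measure_exists\<close>).

  The point is that the Radon-Nikodym derivative \<open>R(z, y; x) = (dP\<^sub>z / dP\<^sub>y)(x)\<close>
  is a function of points of \<open>X\<close>, not of group elements, so that stabilisers cause no
  ambiguity. It is a cocycle: \<open>R(z, y; x) = R(z, y'; x) R(y', y; x)\<close>. For a fixed group
  element \<open>k\<close> put \<open>\<theta>(x, y) = R(k x, y; x)\<close>. The cocycle identity with
  \<open>z = k x\<close> says that the measure \<open>\<theta>(x, y) P\<^sub>y(dx)\<close> does not change
  when \<open>y\<close> moves along its orbit. Hence
  \<open>\<nu> = \<integral> \<theta>(\<cdot>, y) P\<^sub>y \<otimes> \<delta>\<^sub>y d\<zeta>(y)\<close>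
  is invariant under moving the second coordinate, because \<open>\<zeta>\<close> is invariant.

  Invariance of \<open>\<zeta>\<close> is used once more to exchange the coordinates: with
  \<open>x = g y\<close>, the pair \<open>(g y, y)\<close> becomes \<open>(x, g\<^sup>-\<^sup>1 x)\<close>, and
  \<open>\<nu>\<close> is the integral over \<open>\<zeta>(dx)\<close> of the measures \<open>\<nu>\<^sub>x\<close>
  on the fibers that have density \<open>\<theta>(x, \<cdot>)\<close> with respect to the law of
  \<open>g\<^sup>-\<^sup>1 x\<close> (\<open>integral_orbit_measure_eq_tilted_law\<close>). Invariance of
  \<open>\<nu>\<close> under each group element gives invariance of almost every \<open>\<nu>\<^sub>x\<close>
  under almost every group element, and the elements that leave one measure invariant form a
  subgroup; a conull subgroup is the whole group (\<open>invariance_from_conull\<close>). As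
  \<open>\<theta>\<close> is finite and the reference laws are finite, the sets
  \<open>{\<theta> \<le> n}\<close> show that all measures are \<open>\<sigma>\<close>-finite; on the null set of
  \<open>x\<close> where invariance fails, \<open>\<nu>\<^sub>x\<close> is replaced by \<open>0\<close>. For almost every
  other \<open>x\<close> the measure \<open>\<nu>\<^sub>x\<close> is nonzero, because equivalence of the laws along an
  orbit makes \<open>R\<close> positive (\<open>R_pos\<close>).

  Radon-Nikodym derivatives are determined only almost everywhere, whereas \<open>\<theta>\<close> evaluates
  \<open>R\<close> at \<open>z = k x\<close>. Null sets are respected for almost every \<open>k\<close>, since
  replacing \<open>l\<close> by \<open>k g\<close> turns \<open>(l y, g y)\<close> into
  \<open>(k x, x)\<close> with \<open>x = g y\<close> (\<open>AE_law_shear\<close>). This is why \<open>k\<close>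
  is carried along as a random variable and fixed only at the end. Products \<open>k g\<close> in the
  group appear as \<open>k + g\<close> in the formal statements.
\<close>

section \<open>Right Haar measure of a locally compact group\<close>

definition covering_number :: "'g::plus set \<Rightarrow> 'g set \<Rightarrow> nat" where
  "covering_number U K =
     (LEAST n. \<exists>F. finite F \<and> card F = n \<and> K \<subseteq> (\<Union>g\<in>F. (\<lambda>u. u + g) ` U))"

lemma open_right_translate:
  fixes U :: "'g::topological_group_add set"
  assumes "open U"
  shows "open ((\<lambda>u. u + g) ` U)"
proof -
  have "(\<lambda>u. u + g) ` U = (\<lambda>x. x - g) -` U"
    by (force simp: image_iff)
  moreover have "open ((\<lambda>x. x - g) -` U)"
    by (intro open_vimage assms continuous_on_diff continuous_on_id continuous_on_const)
  ultimately show ?thesis by simp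
qed

lemma compact_right_translate:
  fixes K :: "'g::topological_group_add set"
  assumes "compact K"
  shows "compact ((\<lambda>u. u + g) ` K)"
  by (intro compact_continuous_image assms continuous_on_add continuous_on_id continuous_on_const)

lemma finite_right_translate_cover:
  fixes U :: "'g::topological_group_add set"
  assumes "compact K" "open U" "U \<noteq> {}"
  shows "\<exists>F. finite F \<and> K \<subseteq> (\<Union>g\<in>F. (\<lambda>u. u + g) ` U)"
proof -
  obtain u where u: "u \<in> U" using assms(3) by auto
  have "\<And>x. x \<in> (\<lambda>v. v + (- u + x)) ` U"
    using u by (intro image_eqI[of _ _ u]) (simp_all add: add.assoc[symmetric])
  hence "K \<subseteq> (\<Union>g\<in>UNIV. (\<lambda>v. v + g) ` U)" by blast
  thus ?thesis
    using compactE_image[OF assms(1), of UNIV "\<lambda>g. (\<lambda>v. v + g) ` U"]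
      open_right_translate[OF assms(2)] by (metis (full_types))
qed

lemma covering_number_le:
  assumes "finite F" "K \<subseteq> (\<Union>g\<in>F. (\<lambda>u. u + g) ` U)"
  shows "covering_number U K \<le> card F"
  unfolding covering_number_def by (rule Least_le) (use assms in blast)

lemma covering_number_attained:
  fixes U :: "'g::topological_group_add set"
  assumes "compact K" "open U" "U \<noteq> {}"
  obtains F where "finite F" "card F = covering_number U K"
    "K \<subseteq> (\<Union>g\<in>F. (\<lambda>u. u + g) ` U)"
proof -
  have "\<exists>n F. finite F \<and> card F = n \<and> K \<subseteq> (\<Union>g\<in>F. (\<lambda>u. u + g) ` U)"
    using finite_right_translate_cover[OF assms] by blast
  from LeastI_ex[OF this] show ?thesis
    using that unfolding covering_number_def by blast
qed

lemma covering_number_mono: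
  fixes U :: "'g::topological_group_add set"
  assumes "compact L" "open U" "U \<noteq> {}" "K \<subseteq> L"
  shows "covering_number U K \<le> covering_number U L"
proof -
  obtain F where "finite F" "card F = covering_number U L" "L \<subseteq> (\<Union>g\<in>F. (\<lambda>u. u + g) ` U)"
    using covering_number_attained[OF assms(1-3)] .
  thus ?thesis using covering_number_le[of F K U] assms(4) by fastforce
qed

lemma covering_number_subadditive:
  fixes U :: "'g::topological_group_add set"
  assumes "compact K" "compact L" "open U" "U \<noteq> {}"
  shows "covering_number U (K \<union> L) \<le> covering_number U K + covering_number U L"
proof -
  obtain F where F: "finite F" "card F = covering_number U K" "K \<subseteq> (\<Union>g\<in>F. (\<lambda>u. u + g) ` U)"
    using covering_number_attained[OF assms(1,3,4)] .
  obtain F' where F': "finite F'" "card F' = covering_number U L" "L \<subseteq> (\<Union>g\<in>F'. (\<lambda>u. u + g) ` U)"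
    using covering_number_attained[OF assms(2,3,4)] .
  have "covering_number U (K \<union> L) \<le> card (F \<union> F')"
    using F F' by (intro covering_number_le) auto
  also have "\<dots> \<le> card F + card F'" by (rule card_Un_le)
  finally show ?thesis using F F' by simp
qed

text \<open>
  A translate of \<open>U\<close> that met both sets would contain \<open>u + g \<in> K\<close> and
  \<open>v + g \<in> L\<close>, whose quotient \<open>u - v\<close> is excluded. So the translates used for
  \<open>K\<close> and those used for \<open>L\<close> are different.
\<close>
lemma covering_number_additive:
  fixes U :: "'g::topological_group_add set"
  assumes "compact K" "compact L" "open U" "U \<noteq> {}"
    and sep: "\<And>k l u v. k \<in> K \<Longrightarrow> l \<in> L \<Longrightarrow> u \<in> U \<Longrightarrow> v \<in> U \<Longrightarrow> k - l \<noteq> u - v"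
  shows "covering_number U (K \<union> L) = covering_number U K + covering_number U L"
proof (rule antisym[OF covering_number_subadditive[OF assms(1-4)]])
  have "compact (K \<union> L)" using assms by (simp add: compact_Un)
  then obtain F where F: "finite F" "card F = covering_number U (K \<union> L)"
      "K \<union> L \<subseteq> (\<Union>g\<in>F. (\<lambda>u. u + g) ` U)"
    using covering_number_attained[OF _ assms(3,4)] by metis
  let ?T = "\<lambda>g. (\<lambda>u. u + g) ` U"
  let ?A = "{g\<in>F. ?T g \<inter> K \<noteq> {}}" and ?B = "{g\<in>F. ?T g \<inter> L \<noteq> {}}"
  have disj: "?A \<inter> ?B = {}"
  proof (rule ccontr)
    assume "?A \<inter> ?B \<noteq> {}"
    then obtain g u v where uv: "u \<in> U" "v \<in> U" "u + g \<in> K" "v + g \<in> L" by auto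
    have "(u + g) - (v + g) = u - v"
      by (simp add: diff_conv_add_uminus minus_add add.assoc del: add_uminus_conv_diff)
    thus False using sep[OF uv(3,4,1,2)] by simp
  qed
  have "covering_number U K \<le> card ?A" "covering_number U L \<le> card ?B"
    using F(1,3) by (intro covering_number_le; fastforce)+
  hence "covering_number U K + covering_number U L \<le> card (?A \<union> ?B)"
    using disj F(1) by (subst card_Un_disjoint) auto
  also have "\<dots> \<le> card F" using F(1) by (intro card_mono) auto
  finally show "covering_number U K + covering_number U L \<le> covering_number U (K \<union> L)"
    using F(2) by simp
qed

lemma covering_number_translate_le:
  fixes U :: "'g::topological_group_add set"
  assumes "compact K" "open U" "U \<noteq> {}"
  shows "covering_number U ((\<lambda>x. x + h) ` K) \<le> covering_number U K"
proof -
  obtain F where F: "finite F" "card F = covering_number U K" "K \<subseteq> (\<Union>g\<in>F. (\<lambda>u. u + g) ` U)"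
    using covering_number_attained[OF assms] .
  have "(\<lambda>x. x + h) ` K \<subseteq> (\<Union>g\<in>(\<lambda>g. g + h) ` F. (\<lambda>u. u + g) ` U)"
  proof
    fix y assume "y \<in> (\<lambda>x. x + h) ` K"
    then obtain g u where "g \<in> F" "u \<in> U" "y = (u + g) + h" using F(3) by blast
    thus "y \<in> (\<Union>g\<in>(\<lambda>g. g + h) ` F. (\<lambda>u. u + g) ` U)"
      by (auto simp: add.assoc intro!: bexI[of _ g] image_eqI[of _ _ u])
  qed
  hence "covering_number U ((\<lambda>x. x + h) ` K) \<le> card ((\<lambda>g. g + h) ` F)"
    using F(1) by (intro covering_number_le) auto
  also have "\<dots> \<le> card F" by (rule card_image_le[OF F(1)])
  finally show ?thesis using F(2) by simp
qed

lemma covering_number_translate: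
  fixes U :: "'g::topological_group_add set"
  assumes "compact K" "open U" "U \<noteq> {}"
  shows "covering_number U ((\<lambda>x. x + h) ` K) = covering_number U K"
proof (rule antisym[OF covering_number_translate_le[OF assms]])
  have eq: "(\<lambda>x. x + - h) ` (\<lambda>x. x + h) ` K = K" by (simp add: image_image add.assoc)
  have "covering_number U ((\<lambda>x. x + - h) ` (\<lambda>x. x + h) ` K) \<le> covering_number U ((\<lambda>x. x + h) ` K)"
    by (rule covering_number_translate_le[OF compact_right_translate[OF assms(1)] assms(2,3)])
  thus "covering_number U K \<le> covering_number U ((\<lambda>x. x + h) ` K)"
    by (simp only: eq)
qed

text \<open>
  Covering \<open>K\<close> by translates of \<open>V\<close>, and \<open>C \<supseteq> V\<close> by translates of
  \<open>U\<close>, bounds the ratio of the covering numbers of \<open>K\<close> and \<open>C\<close>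
  independently of \<open>U\<close>.
\<close>
lemma covering_number_trans:
  fixes U :: "'g::topological_group_add set"
  assumes "compact K" "compact C" "open U" "U \<noteq> {}" "open V" "V \<noteq> {}" "V \<subseteq> C"
  shows "covering_number U K \<le> covering_number U C * covering_number V K"
proof -
  obtain F where F: "finite F" "card F = covering_number U C" "C \<subseteq> (\<Union>g\<in>F. (\<lambda>u. u + g) ` U)"
    using covering_number_attained[OF assms(2,3,4)] .
  obtain F' where F': "finite F'" "card F' = covering_number V K" "K \<subseteq> (\<Union>g\<in>F'. (\<lambda>u. u + g) ` V)"
    using covering_number_attained[OF assms(1,5,6)] .
  let ?H = "(\<lambda>(f, f'). f + f') ` (F \<times> F')"
  have "K \<subseteq> (\<Union>g\<in>?H. (\<lambda>u. u + g) ` U)"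
  proof
    fix y assume "y \<in> K"
    then obtain f' v where f': "f' \<in> F'" "v \<in> V" "y = v + f'" using F'(3) by blast
    then obtain f u where f: "f \<in> F" "u \<in> U" "v = u + f" using F(3) assms(7) by blast
    show "y \<in> (\<Union>g\<in>?H. (\<lambda>u. u + g) ` U)"
      using f f' by (intro UN_I[of "f + f'"]) (auto simp: add.assoc)
  qed
  hence "covering_number U K \<le> card ?H"
    using F(1) F'(1) by (intro covering_number_le) auto
  also have "\<dots> \<le> card (F \<times> F')" using F(1) F'(1) by (intro card_image_le) auto
  finally show ?thesis using F(2) F'(2) by (simp add: card_cartesian_product)
qed

lemma covering_number_pos:
  fixes U :: "'g::topological_group_add set"
  assumes "compact K" "open U" "U \<noteq> {}" "K \<noteq> {}"
  shows "0 < covering_number U K"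
proof -
  obtain F where "finite F" "card F = covering_number U K" "K \<subseteq> (\<Union>g\<in>F. (\<lambda>u. u + g) ` U)"
    using covering_number_attained[OF assms(1-3)] .
  thus ?thesis using assms(4) by (cases "F = {}") (auto simp: card_gt_0_iff)
qed

text \<open>
  The differences \<open>k - l\<close> form a compact set that misses \<open>0\<close>, and
  \<open>(u, v) \<mapsto> u - v\<close> is continuous at \<open>(0, 0)\<close>. With
  \<open>covering_number_additive\<close> this makes covering numbers by small neighbourhoods additive.
\<close>
lemma disjoint_compacts_separated:
  fixes K :: "'g::{topological_group_add, t2_space} set"
  assumes "compact K" "compact L" "K \<inter> L = {}"
  shows "\<exists>W. open W \<and> 0 \<in> W \<and> (\<forall>k\<in>K. \<forall>l\<in>L. \<forall>u\<in>W. \<forall>v\<in>W. k - l \<noteq> u - v)"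
proof -
  let ?D = "(\<lambda>p. fst p - snd p) ` (K \<times> L)"
  have "compact ?D"
    by (intro compact_continuous_image compact_Times assms continuous_on_diff
        continuous_on_fst continuous_on_snd continuous_on_id)
  hence "open (- ?D)" by (simp add: compact_imp_closed open_Compl)
  moreover have "continuous_on UNIV (\<lambda>p::'g\<times>'g. fst p - snd p)"
    by (intro continuous_on_diff continuous_on_fst continuous_on_snd continuous_on_id)
  ultimately have op: "open ((\<lambda>p::'g\<times>'g. fst p - snd p) -` (- ?D))"
    by (rule open_vimage)
  have "(0, 0) \<in> (\<lambda>p::'g\<times>'g. fst p - snd p) -` (- ?D)" using assms(3) by force
  from open_prod_elim[OF op this] obtain A B where AB: "open A" "open B" "(0, 0) \<in> A \<times> B"
      "A \<times> B \<subseteq> (\<lambda>p::'g\<times>'g. fst p - snd p) -` (- ?D)" .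
  show ?thesis
  proof (intro exI[of _ "A \<inter> B"] conjI ballI)
    show "open (A \<inter> B)" "0 \<in> A \<inter> B" using AB by auto
    fix k l u v assume "k \<in> K" "l \<in> L" "u \<in> A \<inter> B" "v \<in> A \<inter> B"
    moreover from this have "u - v \<notin> ?D"
      using subsetD[OF AB(4), of "(u, v)"] by simp
    ultimately show "k - l \<noteq> u - v" by (force simp: image_iff)
  qed
qed

definition invariant_content :: "('g::{topological_group_add, t2_space} set \<Rightarrow> real) \<Rightarrow> bool" where
  "invariant_content h \<longleftrightarrow>
     (\<forall>K. compact K \<longrightarrow> 0 \<le> h K) \<and>
     (\<forall>K L. compact K \<longrightarrow> compact L \<longrightarrow> K \<subseteq> L \<longrightarrow> h K \<le> h L) \<and>
     (\<forall>K L. compact K \<longrightarrow> compact L \<longrightarrow> h (K \<union> L) \<le> h K + h L) \<and>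
     (\<forall>K L. compact K \<longrightarrow> compact L \<longrightarrow> K \<inter> L = {} \<longrightarrow> h (K \<union> L) = h K + h L) \<and>
     (\<forall>K g. compact K \<longrightarrow> h ((\<lambda>x. x + g) ` K) = h K) \<and>
     (\<exists>K. compact K \<and> h K = 1)"

text \<open>
  For neighbourhoods \<open>U\<^sub>n\<close> shrinking to the identity, the number of translates of
  \<open>U\<^sub>n\<close> needed to cover \<open>K\<close>, divided by the number needed for a fixed compact
  neighbourhood \<open>C\<close>, is bounded in \<open>n\<close>. By Tychonoff's theorem these ratios have a
  cluster point as functions of \<open>K\<close>. Every property of a content that holds for the ratios
  eventually is inherited by the cluster point; additivity on disjoint sets holds once
  \<open>U\<^sub>n\<close> is small enough.
\<close>
lemma invariant_content_exists:
  assumes lc: "locally_compact_space (euclidean :: 'g::{topological_group_add, t2_space, second_countable_topology} topology)"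
  shows "\<exists>h :: 'g set \<Rightarrow> real. invariant_content h"
proof -
  have "\<exists>V C :: 'g set. open V \<and> compact C \<and> 0 \<in> V \<and> V \<subseteq> C"
    using lc by (simp add: locally_compact_space_def)
  then obtain V C :: "'g set" where VC: "open V" "compact C" "0 \<in> V" "V \<subseteq> C"
    by blast
  have V: "V \<noteq> {}" and C: "C \<noteq> {}" using VC by auto
  obtain U :: "nat \<Rightarrow> 'g set" where U: "\<And>n. open (U n)" "\<And>n. 0 \<in> U n"
      "\<And>S. open S \<Longrightarrow> 0 \<in> S \<Longrightarrow> eventually (\<lambda>n. U n \<subseteq> S) sequentially"
    using countable_basis_at_decseq[of "0::'g"] by metis
  have U0: "\<And>n. U n \<noteq> {}" using U(2) by blast
  define r :: "nat \<Rightarrow> 'g set \<Rightarrow> real" where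
    "r n K = (if compact K then covering_number (U n) K / covering_number (U n) C else 0)" for n K
  define B :: "'g set \<Rightarrow> real set" where
    "B K = {0..real (covering_number V K)}" for K
  have pos: "0 < real (covering_number (U n) C)" for n
    using covering_number_pos[OF VC(2) U(1) U0 C] by simp
  have rB: "r n \<in> PiE UNIV B" for n
  proof (rule PiE_I)
    fix K :: "'g set"
    show "r n K \<in> B K"
    proof (cases "compact K")
      case True
      have "real (covering_number (U n) K) \<le> real (covering_number (U n) C) * real (covering_number V K)"
        using covering_number_trans[OF True VC(2) U(1) U0 VC(1) V VC(4)]
        by (metis of_nat_le_iff of_nat_mult)
      thus ?thesis using True pos[of n] by (simp add: r_def B_def field_simps)
    qed (simp add: r_def B_def)
  qed simp
  have "compact (PiE UNIV B)"
    using compactin_PiE[of "\<lambda>_. euclidean" UNIV B]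
    by (simp add: euclidean_product_topology B_def)
  moreover have "filtermap r sequentially \<noteq> bot" by (simp add: filtermap_bot_iff)
  moreover have "eventually (\<lambda>f. f \<in> PiE UNIV B) (filtermap r sequentially)"
    using rB by (simp add: eventually_filtermap)
  ultimately obtain h where h: "inf (nhds h) (filtermap r sequentially) \<noteq> bot"
    unfolding compact_filter by blast
  \<comment> \<open>Along this filter the ratios converge to the cluster point at every \<open>K\<close>.\<close>
  define F where "F = inf (nhds h) (filtermap r sequentially)"
  have F: "F \<noteq> bot" using h by (simp add: F_def)
  have lim: "((\<lambda>f. f K) \<longlongrightarrow> h K) F" for K
  proof -
    have "((\<lambda>f. f K) \<longlongrightarrow> h K) (nhds h)"
    proof (rule topological_tendstoI)
      fix S :: "real set" assume S: "open S" "h K \<in> S"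
      have "open ((\<lambda>f::'g set \<Rightarrow> real. f K) -` S)"
        by (rule open_vimage[OF S(1) continuous_on_product_coordinates])
      thus "\<forall>\<^sub>F f in nhds h. f K \<in> S"
        using S(2) eventually_nhds_in_open[of "(\<lambda>f. f K) -` S" h] by simp
    qed
    thus ?thesis unfolding F_def by (rule tendsto_mono[rotated]) simp
  qed
  have ev: "eventually P F" if "eventually (\<lambda>n. P (r n)) sequentially" for P
    using that filter_leD[of F "filtermap r sequentially" P] by (simp add: F_def eventually_filtermap)
  have rd: "compact K \<Longrightarrow> r n K = covering_number (U n) K / covering_number (U n) C" for n K
    by (simp add: r_def)
  have "0 \<le> h K" if "compact K" for K
  proof (rule tendsto_lowerbound[OF lim _ F])
    show "\<forall>\<^sub>F f in F. 0 \<le> f K" by (intro ev always_eventually allI) (simp add: r_def)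
  qed
  moreover have "h K \<le> h L" if "compact K" "compact L" "K \<subseteq> L" for K L
  proof (rule tendsto_le[OF F lim lim])
    show "\<forall>\<^sub>F f in F. f K \<le> f L"
      using covering_number_mono[OF that(2) U(1) U0 that(3)] that
      by (intro ev always_eventually allI) (simp add: rd divide_right_mono)
  qed
  moreover have "h (K \<union> L) \<le> h K + h L" if "compact K" "compact L" for K L
  proof (rule tendsto_le[OF F tendsto_add[OF lim lim] lim])
    have "covering_number (U n) (K \<union> L) \<le> real (covering_number (U n) K + covering_number (U n) L)" for n
      using covering_number_subadditive[OF that U(1) U0] of_nat_le_iff by blast
    thus "\<forall>\<^sub>F f in F. f (K \<union> L) \<le> f K + f L"
      using that by (intro ev always_eventually allI)
        (simp add: rd compact_Un add_divide_distrib[symmetric] divide_right_mono)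
  qed
  moreover have "h (K \<union> L) = h K + h L" if "compact K" "compact L" "K \<inter> L = {}" for K L
  proof -
    from disjoint_compacts_separated[OF that] obtain W where W: "open W" "0 \<in> W"
      "\<forall>k\<in>K. \<forall>l\<in>L. \<forall>u\<in>W. \<forall>v\<in>W. k - l \<noteq> u - v"
      by (elim exE conjE)
    have "\<forall>\<^sub>F n in sequentially. r n K + r n L = r n (K \<union> L)"
      using U(3)[OF W(1,2)]
    proof eventually_elim
      case (elim n)
      have "covering_number (U n) (K \<union> L) = covering_number (U n) K + covering_number (U n) L"
        using elim W(3) by (intro covering_number_additive that(1,2) U(1) U0) blast
      thus ?case using that by (simp add: rd compact_Un add_divide_distrib)
    qed
    hence "((\<lambda>f. f (K \<union> L)) \<longlongrightarrow> h K + h L) F"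
      by (intro Lim_transform_eventually[OF tendsto_add[OF lim lim]] ev)
    thus ?thesis using tendsto_unique[OF F lim] by blast
  qed
  moreover have "h ((\<lambda>x. x + g) ` K) = h K" if "compact K" for K g
  proof -
    have "((\<lambda>f. f ((\<lambda>x. x + g) ` K)) \<longlongrightarrow> h K) F"
      using covering_number_translate[OF that U(1) U0] that compact_right_translate[OF that]
      by (intro Lim_transform_eventually[OF lim] ev always_eventually allI) (simp add: rd)
    thus ?thesis using tendsto_unique[OF F lim] by blast
  qed
  moreover have "h C = 1"
  proof -
    have "((\<lambda>f. f C) \<longlongrightarrow> 1) F"
      using pos VC(2)
      by (intro tendsto_eventually ev always_eventually allI) (simp add: rd)
    thus ?thesis using tendsto_unique[OF F lim] by blast
  qed
  ultimately show ?thesis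
    unfolding invariant_content_def
    by (intro exI[of _ h] conjI allI impI exI[of _ C] VC(2)) assumption+
qed


definition inner_content :: "('g::topological_space set \<Rightarrow> real) \<Rightarrow> 'g set \<Rightarrow> ennreal" where
  "inner_content h U = (SUP K\<in>{K. compact K \<and> K \<subseteq> U}. ennreal (h K))"

definition content_outer_measure :: "('g::topological_space set \<Rightarrow> real) \<Rightarrow> 'g set \<Rightarrow> ennreal" where
  "content_outer_measure h A = (INF U\<in>{U. open U \<and> A \<subseteq> U}. inner_content h U)"

lemma inner_content_upper: "compact K \<Longrightarrow> K \<subseteq> U \<Longrightarrow> ennreal (h K) \<le> inner_content h U"
  unfolding inner_content_def by (rule SUP_upper) simp

lemma content_outer_measure_le: "open U \<Longrightarrow> A \<subseteq> U \<Longrightarrow> content_outer_measure h A \<le> inner_content h U"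
  unfolding content_outer_measure_def by (rule INF_lower) simp

lemma content_outer_measure_mono:
  "A \<subseteq> B \<Longrightarrow> content_outer_measure h A \<le> content_outer_measure h B"
  unfolding content_outer_measure_def by (rule INF_superset_mono) auto

lemma le_content_outer_measure:
  "compact K \<Longrightarrow> K \<subseteq> A \<Longrightarrow> ennreal (h K) \<le> content_outer_measure h A"
  unfolding content_outer_measure_def by (rule INF_greatest) (auto intro: inner_content_upper)

text \<open>
  Remove from \<open>K\<close> disjoint open neighbourhoods of the disjoint compact sets
  \<open>K - U\<close> and \<open>K - V\<close>.
\<close>
lemma compact_subset_Un_split:
  fixes K :: "'a::t2_space set"
  assumes K: "compact K" "K \<subseteq> U \<union> V" and UV: "open U" "open V"
  obtains K1 K2 where "compact K1" "compact K2" "K1 \<subseteq> U" "K2 \<subseteq> V" "K = K1 \<union> K2"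
proof -
  have c: "compact (K - U)" "compact (K - V)" using K(1) UV by (simp_all add: compact_diff)
  have d: "disjnt (K - U) (K - V)" using K(2) by (auto simp: disjnt_def)
  have H: "Hausdorff_space (euclidean :: 'a topology)"
    unfolding Hausdorff_space_def
  proof (intro allI impI)
    fix x y :: 'a assume "x \<in> topspace euclidean \<and> y \<in> topspace euclidean \<and> x \<noteq> y"
    then obtain A B where "open A" "open B" "x \<in> A" "y \<in> B" "A \<inter> B = {}"
      using hausdorff[of x y] by auto
    thus "\<exists>A B. openin euclidean A \<and> openin euclidean B \<and> x \<in> A \<and> y \<in> B \<and> disjnt A B"
      by (intro exI[of _ A] exI[of _ B]) (simp add: disjnt_def)
  qed
  obtain A B where AB: "open A" "open B" "K - U \<subseteq> A" "K - V \<subseteq> B" "disjnt A B"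
    by (rule Hausdorff_space_compact_separation[OF H, of "K - U" "K - V"]) (use c d in simp_all)
  show ?thesis
  proof (rule that[of "K - A" "K - B"])
    show "compact (K - A)" "compact (K - B)" using K(1) AB(1,2) by (simp_all add: compact_diff)
    show "K - A \<subseteq> U" "K - B \<subseteq> V" using AB(3,4) by auto
    show "K = (K - A) \<union> (K - B)" using AB(5) by (auto simp: disjnt_iff)
  qed
qed

context
  fixes h :: "'g::{topological_group_add, t2_space, second_countable_topology} set \<Rightarrow> real"
  assumes h: "invariant_content h"
begin

lemma content_nonneg: "compact K \<Longrightarrow> 0 \<le> h K"
  and content_mono: "compact K \<Longrightarrow> compact L \<Longrightarrow> K \<subseteq> L \<Longrightarrow> h K \<le> h L"
  and content_subadditive: "compact K \<Longrightarrow> compact L \<Longrightarrow> h (K \<union> L) \<le> h K + h L"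
  and content_additive: "compact K \<Longrightarrow> compact L \<Longrightarrow> K \<inter> L = {} \<Longrightarrow> h (K \<union> L) = h K + h L"
  and content_translate: "compact K \<Longrightarrow> h ((\<lambda>x. x + g) ` K) = h K"
  using h by (simp_all add: invariant_content_def)

lemma content_empty: "h {} = 0"
  using content_additive[of "{}" "{}"] by simp

lemma content_le_sum_inner_content:
  assumes "\<And>i::nat. open (U i)"
  shows "compact K \<Longrightarrow> K \<subseteq> (\<Union>i<n. U i) \<Longrightarrow> ennreal (h K) \<le> (\<Sum>i<n. inner_content h (U i))"
proof (induction n arbitrary: K)
  case 0
  thus ?case by (simp add: content_empty)
next
  case (Suc n)
  have "K \<subseteq> (\<Union>i<n. U i) \<union> U n" using Suc.prems(2) by (auto simp: lessThan_Suc)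
  then obtain K1 K2 where K12: "compact K1" "compact K2" "K1 \<subseteq> (\<Union>i<n. U i)" "K2 \<subseteq> U n" "K = K1 \<union> K2"
    using compact_subset_Un_split[OF Suc.prems(1)] assms by (metis open_UN)
  have "ennreal (h K) \<le> ennreal (h K1 + h K2)"
    using content_subadditive[OF K12(1,2)] K12(5) by (simp add: ennreal_leI)
  also have "\<dots> = ennreal (h K1) + ennreal (h K2)"
    by (intro ennreal_plus content_nonneg K12)
  also have "\<dots> \<le> (\<Sum>i<n. inner_content h (U i)) + inner_content h (U n)"
    by (intro add_mono Suc.IH inner_content_upper K12)
  finally show ?case by simp
qed

lemma inner_content_UN_le:
  assumes "\<And>i::nat. open (U i)"
  shows "inner_content h (\<Union>i. U i) \<le> (\<Sum>i. inner_content h (U i))"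
  unfolding inner_content_def[of h "\<Union>i. U i"]
proof (rule SUP_least, clarify)
  fix K assume K: "compact K" "K \<subseteq> (\<Union>i. U i)"
  obtain D where D: "finite D" "K \<subseteq> (\<Union>i\<in>D. U i)"
    using compactE_image[OF K(1), of UNIV U] assms K(2) by metis
  have "D \<subseteq> {..<Suc (Max D)}" using D(1) by (auto simp: less_Suc_eq_le)
  hence "K \<subseteq> (\<Union>i<Suc (Max D). U i)" using D(2) by blast
  hence "ennreal (h K) \<le> (\<Sum>i<Suc (Max D). inner_content h (U i))"
    by (rule content_le_sum_inner_content[OF assms K(1)])
  also have "\<dots> \<le> (\<Sum>i. inner_content h (U i))" by (rule sum_le_suminf) auto
  finally show "ennreal (h K) \<le> (\<Sum>i. inner_content h (U i))" .
qed

lemma content_outer_measure_empty: "content_outer_measure h {} = 0"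
proof -
  have "{K :: 'g set. compact K \<and> K \<subseteq> {}} = {{}}" by auto
  hence "inner_content h {} = 0"
    unfolding inner_content_def by (simp only: image_insert image_empty ccpo_Sup_singleton content_empty ennreal_0)
  thus ?thesis using content_outer_measure_le[of "{}" "{}" h] by simp
qed

lemma content_outer_measure_UN_le:
  "content_outer_measure h (\<Union>i::nat. A i) \<le> (\<Sum>i. content_outer_measure h (A i))"
proof (rule ennreal_le_epsilon)
  fix e :: real assume e: "0 < e" and fin: "(\<Sum>i. content_outer_measure h (A i)) < top"
  have fin_i: "content_outer_measure h (A i) < top" for i
    using fin by (metis ennreal_suminf_lessD)
  have "\<exists>U. open U \<and> A i \<subseteq> U \<and>
      inner_content h U \<le> content_outer_measure h (A i) + ennreal (e * (1/2) ^ Suc i)" for i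
  proof -
    have "content_outer_measure h (A i) < content_outer_measure h (A i) + ennreal (e * (1/2) ^ Suc i)"
      using fin_i[of i] e ennreal_add_left_cancel_less[of "content_outer_measure h (A i)" 0] by simp
    thus ?thesis
      unfolding content_outer_measure_def[of h "A i"] INF_less_iff by (auto intro: less_imp_le)
  qed
  then obtain U where U: "\<And>i. open (U i)" "\<And>i. A i \<subseteq> U i"
    "\<And>i. inner_content h (U i) \<le> content_outer_measure h (A i) + ennreal (e * (1/2) ^ Suc i)"
    by metis
  have "content_outer_measure h (\<Union>i. A i) \<le> inner_content h (\<Union>i. U i)"
    using U(1,2) by (intro content_outer_measure_le open_UN) blast+
  also have "\<dots> \<le> (\<Sum>i. inner_content h (U i))" by (rule inner_content_UN_le[OF U(1)])
  also have "\<dots> \<le> (\<Sum>i. content_outer_measure h (A i) + ennreal (e * (1/2) ^ Suc i))"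
    by (intro suminf_le U(3)) auto
  also have "\<dots> = (\<Sum>i. content_outer_measure h (A i)) + (\<Sum>i. ennreal (e * (1/2) ^ Suc i))"
    by (rule suminf_add[symmetric]) auto
  also have "(\<Sum>i. ennreal (e * (1/2) ^ Suc i)) = ennreal e"
    using sums_mult[OF power_half_series, of e] e by (intro suminf_ennreal_eq) auto
  finally show "content_outer_measure h (\<Union>i. A i) \<le> (\<Sum>i. content_outer_measure h (A i)) + ennreal e" .
qed

lemma content_outer_measure_Un_le:
  "content_outer_measure h (A \<union> B) \<le> content_outer_measure h A + content_outer_measure h B"
  using content_outer_measure_UN_le[of "binaryset A B"]
  by (simp add: UN_binaryset_eq suminf_binaryset_eq content_outer_measure_empty)

text \<open>
  Exhaust \<open>V \<inter> U\<close> by a compact \<open>K\<close> and then the open set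
  \<open>V - K \<supseteq> V - U\<close> by a compact \<open>L\<close>. As \<open>K\<close> and \<open>L\<close>
  are disjoint subsets of \<open>V\<close>, their contents add up to at most that of \<open>V\<close>. This is
  the inequality behind the measurability of open sets.
\<close>
lemma inner_content_split:
  assumes "open U" "open V"
  shows "inner_content h (V \<inter> U) + content_outer_measure h (V - U) \<le> inner_content h V"
proof -
  have "ennreal (h K) + content_outer_measure h (V - U) \<le> inner_content h V"
    if K: "compact K" "K \<subseteq> V \<inter> U" for K
  proof -
    have "open (V - K)" using assms K by (intro open_Diff compact_imp_closed)
    hence "content_outer_measure h (V - U) \<le> inner_content h (V - K)"
      using K(2) by (intro content_outer_measure_le) auto
    hence "ennreal (h K) + content_outer_measure h (V - U) \<le> ennreal (h K) + inner_content h (V - K)"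
      by (rule add_left_mono)
    also have "\<dots> = (SUP L\<in>{L. compact L \<and> L \<subseteq> V - K}. ennreal (h K) + ennreal (h L))"
      unfolding inner_content_def by (subst ennreal_SUP_add_right) auto
    also have "\<dots> \<le> inner_content h V"
    proof (rule SUP_least, clarify)
      fix L assume L: "compact L" "L \<subseteq> V - K"
      have "K \<inter> L = {}" using L(2) by auto
      hence "ennreal (h K) + ennreal (h L) = ennreal (h (K \<union> L))"
        using content_additive[OF K(1) L(1)] L(2) content_nonneg K(1) L(1)
        by (subst ennreal_plus[symmetric]) auto
      also have "\<dots> \<le> inner_content h V"
        using K L by (intro inner_content_upper compact_Un) auto
      finally show "ennreal (h K) + ennreal (h L) \<le> inner_content h V" .
    qed
    finally show ?thesis .
  qed
  thus ?thesis
    unfolding inner_content_def[of h "V \<inter> U"]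
    by (subst ennreal_SUP_add_left[symmetric]) (auto intro!: SUP_least)
qed

lemma open_in_lambda_system:
  assumes "open U"
  shows "U \<in> lambda_system UNIV (Pow UNIV) (content_outer_measure h)"
proof -
  let ?m = "content_outer_measure h"
  have "?m (U \<inter> A) + ?m ((UNIV - U) \<inter> A) = ?m A" for A
  proof (rule antisym)
    show "?m (U \<inter> A) + ?m ((UNIV - U) \<inter> A) \<le> ?m A"
      unfolding content_outer_measure_def[of h A]
    proof (rule INF_greatest, clarify)
      fix V assume V: "open V" "A \<subseteq> V"
      have "?m (U \<inter> A) \<le> inner_content h (V \<inter> U)"
        using V assms by (intro content_outer_measure_le) auto
      moreover have "?m ((UNIV - U) \<inter> A) \<le> ?m (V - U)"
        using V by (intro content_outer_measure_mono) auto
      ultimately have "?m (U \<inter> A) + ?m ((UNIV - U) \<inter> A) \<le> inner_content h (V \<inter> U) + ?m (V - U)"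
        by (rule add_mono)
      also have "\<dots> \<le> inner_content h V" by (rule inner_content_split[OF assms V(1)])
      finally show "?m (U \<inter> A) + ?m ((UNIV - U) \<inter> A) \<le> inner_content h V" .
    qed
    have "(U \<inter> A) \<union> ((UNIV - U) \<inter> A) = A" by auto
    thus "?m A \<le> ?m (U \<inter> A) + ?m ((UNIV - U) \<inter> A)"
      using content_outer_measure_Un_le[of "U \<inter> A" "(UNIV - U) \<inter> A"] by simp
  qed
  thus ?thesis by (simp add: lambda_system_def)
qed

text \<open>
  Open sets satisfy the Caratheodory criterion, hence so do all Borel sets.
\<close>
lemma measure_space_content_outer_measure:
  "measure_space UNIV (sets (borel :: 'g measure)) (content_outer_measure h)"
proof -
  interpret P: sigma_algebra UNIV "Pow (UNIV :: 'g set)" by (rule sigma_algebra_Pow)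
  have "outer_measure_space (Pow UNIV) (content_outer_measure h)"
    unfolding outer_measure_space_def positive_def increasing_def countably_subadditive_def
    by (intro conjI ballI allI impI content_outer_measure_empty content_outer_measure_mono
        content_outer_measure_UN_le)
  hence ms: "measure_space UNIV (lambda_system UNIV (Pow UNIV) (content_outer_measure h))
      (content_outer_measure h)"
    by (rule P.caratheodory_lemma)
  moreover have "sigma_algebra UNIV (sets (borel :: 'g measure))"
    using sets.sigma_algebra_axioms[of "borel :: 'g measure"] by simp
  moreover have "sets (borel :: 'g measure) \<subseteq> lambda_system UNIV (Pow UNIV) (content_outer_measure h)"
  proof -
    have "sigma_algebra UNIV (lambda_system UNIV (Pow UNIV) (content_outer_measure h))"
      using ms by (simp add: measure_space_def)
    hence "sigma_sets UNIV {S. open S} \<subseteq> lambda_system UNIV (Pow UNIV) (content_outer_measure h)"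
      by (rule sigma_algebra.sigma_sets_subset) (use open_in_lambda_system in auto)
    thus ?thesis by (simp add: borel_def)
  qed
  ultimately show ?thesis by (rule measure_down)
qed

lemma content_outer_measure_translate_le:
  "content_outer_measure h ((\<lambda>x. x + g) ` A) \<le> content_outer_measure h A"
  unfolding content_outer_measure_def[of h A]
proof (rule INF_greatest, clarify)
  fix U assume U: "open U" "A \<subseteq> U"
  have "content_outer_measure h ((\<lambda>x. x + g) ` A) \<le> inner_content h ((\<lambda>x. x + g) ` U)"
    using U by (intro content_outer_measure_le open_right_translate) auto
  also have "\<dots> \<le> inner_content h U"
    unfolding inner_content_def[of h "(\<lambda>x. x + g) ` U"]
  proof (rule SUP_least, clarify)
    fix K assume K: "compact K" "K \<subseteq> (\<lambda>x. x + g) ` U"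
    have "(\<lambda>x. x + - g) ` K \<subseteq> U" using K(2) by (force simp: add.assoc)
    hence "ennreal (h ((\<lambda>x. x + - g) ` K)) \<le> inner_content h U"
      by (intro inner_content_upper compact_right_translate K(1))
    thus "ennreal (h K) \<le> inner_content h U" using content_translate[OF K(1), of "- g"] by simp
  qed
  finally show "content_outer_measure h ((\<lambda>x. x + g) ` A) \<le> inner_content h U" .
qed

lemma content_outer_measure_translate:
  "content_outer_measure h ((\<lambda>x. x + g) ` A) = content_outer_measure h A"
proof (rule antisym[OF content_outer_measure_translate_le])
  have eq: "(\<lambda>x. x + - g) ` (\<lambda>x. x + g) ` A = A" by (simp add: image_image add.assoc)
  have "content_outer_measure h ((\<lambda>x. x + - g) ` (\<lambda>x. x + g) ` A) \<le> content_outer_measure h ((\<lambda>x. x + g) ` A)"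
    by (rule content_outer_measure_translate_le)
  thus "content_outer_measure h A \<le> content_outer_measure h ((\<lambda>x. x + g) ` A)"
    by (simp only: eq)
qed

end

theorem right_haar_measure_exists:
  assumes lc: "locally_compact_space (euclidean :: 'g::{topological_group_add, t2_space, second_countable_topology} topology)"
  shows "\<exists>\<mu> :: 'g measure. sets \<mu> = sets borel \<and> sigma_finite_measure \<mu> \<and> emeasure \<mu> UNIV \<noteq> 0 \<and>
    (\<forall>A\<in>sets borel. \<forall>g. emeasure \<mu> ((\<lambda>x. x + g) ` A) = emeasure \<mu> A)"
proof -
  obtain h :: "'g set \<Rightarrow> real" where h: "invariant_content h"
    using invariant_content_exists[OF lc] by auto
  let ?m = "content_outer_measure h"
  define \<mu> where "\<mu> = measure_of UNIV (sets (borel :: 'g measure)) ?m"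
  have sets[simp]: "sets \<mu> = sets borel"
    unfolding \<mu>_def using sets.sets_measure_of_eq[of "borel :: 'g measure" ?m] by simp
  have sp[simp]: "space \<mu> = UNIV" using sets_eq_imp_space_eq[OF sets] by simp
  have em: "emeasure \<mu> A = ?m A" if "A \<in> sets borel" for A
    using measure_space_content_outer_measure[OF h] that unfolding \<mu>_def
    by (subst emeasure_measure_of_sigma) (auto simp: measure_space_def)
  have tr: "(\<lambda>x. x + g) ` A \<in> sets borel" if "A \<in> sets borel" for g and A :: "'g set"
  proof -
    have "(\<lambda>x. x + g) ` A = (\<lambda>x. x - g) -` A \<inter> space borel" by (force simp: image_iff)
    moreover have "(\<lambda>x. x - g) \<in> borel_measurable borel"
      by (intro borel_measurable_continuous_onI continuous_on_diff continuous_on_id continuous_on_const)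
    ultimately show ?thesis using measurable_sets[of "\<lambda>x. x - g" borel borel A] that by simp
  qed
  have "emeasure \<mu> ((\<lambda>x. x + g) ` A) = emeasure \<mu> A" if "A \<in> sets borel" for A g
    using that by (simp add: em tr content_outer_measure_translate[OF h])
  moreover have "emeasure \<mu> UNIV \<noteq> 0"
  proof -
    have "\<exists>K. compact K \<and> h K = 1" using h unfolding invariant_content_def by (elim conjE)
    then obtain K where "compact K" "h K = 1" by auto
    hence "1 \<le> emeasure \<mu> UNIV" using le_content_outer_measure[of K UNIV h] by (simp add: em)
    thus "emeasure \<mu> UNIV \<noteq> 0" by (metis not_one_le_zero)
  qed
  moreover have "sigma_finite_measure \<mu>"
  proof -
    let ?F = "{U :: 'g set. open U \<and> (\<exists>K. compact K \<and> U \<subseteq> K)}"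
    have "\<And>U. U \<in> ?F \<Longrightarrow> open U" by simp
    then obtain F' where F': "F' \<subseteq> ?F" "countable F'" "\<Union>F' = \<Union>?F"
      by (rule Lindelof)
    have "\<forall>x::'g. \<exists>U. open U \<and> (\<exists>K. compact K \<and> x \<in> U \<and> U \<subseteq> K)"
      using lc by (simp add: locally_compact_space_def)
    hence "\<Union>?F = UNIV" by blast
    moreover have "emeasure \<mu> U \<noteq> \<infinity>" if "U \<in> F'" for U
    proof -
      obtain K where K: "open U" "compact K" "U \<subseteq> K" using F'(1) \<open>U \<in> F'\<close> by auto
      have "emeasure \<mu> U \<le> inner_content h U"
        using K by (simp add: em content_outer_measure_le)
      also have "\<dots> \<le> ennreal (h K)"
        unfolding inner_content_def
        using K by (intro SUP_least) (auto intro!: ennreal_leI content_mono[OF h])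
      finally show ?thesis using ennreal_less_top[of "h K"] by (auto simp: top_unique)
    qed
    ultimately show ?thesis
      using F' by (intro sigma_finite_measure.intro exI[of _ F']) auto
  qed
  ultimately show ?thesis
    by (intro exI[of _ \<mu>] conjI ballI allI sets) assumption+
qed

text \<open>
  Multiplying Haar measure by a positive integrable function makes it finite and keeps the null
  sets. It is the invariance of the null sets that is used below.
\<close>
corollary quasi_invariant_finite_measure_exists:
  assumes lc: "locally_compact_space (euclidean :: 'g::{topological_group_add, t2_space, second_countable_topology} topology)"
  shows "\<exists>p :: 'g measure. sets p = sets borel \<and> finite_measure p \<and> emeasure p UNIV \<noteq> 0 \<and>
    (\<forall>A\<in>null_sets p. \<forall>g. (\<lambda>x. x + g) -` A \<in> null_sets p)"
proof -
  obtain \<mu> :: "'g measure" where \<mu>: "sets \<mu> = sets borel" "sigma_finite_measure \<mu>"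
    "emeasure \<mu> UNIV \<noteq> 0"
    and inv: "\<forall>A\<in>sets borel. \<forall>g. emeasure \<mu> ((\<lambda>x. x + g) ` A) = emeasure \<mu> A"
    using right_haar_measure_exists[OF lc] by (elim exE conjE)
  have sp: "space \<mu> = UNIV" using sets_eq_imp_space_eq[OF \<mu>(1)] by simp
  obtain w where w: "w \<in> borel_measurable \<mu>" "integral\<^sup>N \<mu> w \<noteq> \<infinity>" "\<And>x. 0 < w x"
    using sigma_finite_measure.Ex_finite_integrable_function[OF \<mu>(2)] sp by auto
  define p where "p = density \<mu> w"
  have null: "A \<in> null_sets p \<longleftrightarrow> A \<in> null_sets \<mu>" for A
  proof -
    have "\<And>x. w x \<noteq> 0" using w(3) by (metis less_irrefl)
    hence "A \<in> null_sets p \<longleftrightarrow> A \<in> sets \<mu> \<and> (AE x in \<mu>. x \<notin> A)"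
      unfolding p_def null_sets_density_iff[OF w(1)] by simp
    thus ?thesis using AE_iff_null_sets[of A \<mu>] by (auto dest: null_setsD2)
  qed
  show ?thesis
  proof (intro exI[of _ p] conjI ballI allI)
    show "sets p = sets borel" by (simp add: p_def \<mu>(1))
    show "finite_measure p"
    proof
      have "emeasure p (space p) = integral\<^sup>N \<mu> w"
        using w(1) by (simp add: p_def emeasure_density cong: nn_integral_cong)
      thus "emeasure p (space p) \<noteq> \<infinity>" using w(2) by simp
    qed
    have "UNIV \<notin> null_sets p" using \<mu>(3) null[of UNIV] by (auto simp: null_sets_def)
    thus "emeasure p UNIV \<noteq> 0" using \<mu>(1) by (auto simp: null_sets_def p_def)
    fix A g assume "A \<in> null_sets p"
    hence A: "A \<in> null_sets \<mu>" by (simp add: null)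
    have im: "(\<lambda>x. x + g) -` A = (\<lambda>x. x + - g) ` A" by (force simp: image_iff add.assoc)
    have "(\<lambda>x. x + g) \<in> borel_measurable (borel :: 'g measure)"
      by (intro borel_measurable_continuous_onI continuous_on_add continuous_on_id continuous_on_const)
    hence "(\<lambda>x. x + g) -` A \<in> sets \<mu>"
      using measurable_sets[of "\<lambda>x. x + g" borel borel A] A \<mu>(1) by (simp add: null_sets_def)
    moreover have "emeasure \<mu> ((\<lambda>x. x + g) -` A) = 0"
      unfolding im using bspec[OF inv, of A, THEN spec, of "- g"] A \<mu>(1) by (simp add: null_sets_def)
    ultimately show "(\<lambda>x. x + g) -` A \<in> null_sets p"
      unfolding null by (rule null_setsI[rotated])
  qed
qed

section \<open>Radon-Nikodym derivatives depending on a parameter\<close>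

text \<open>
  The derivative of the law of \<open>\<psi> y\<close> with respect to the law of \<open>\<phi> y\<close>
  can be chosen jointly measurable in \<open>y\<close> and the point: take the derivative \<open>D\<close> of the
  joint laws of \<open>(y, \<psi> y g)\<close> and \<open>(y, \<phi> y g)\<close>. Testing \<open>D\<close> on
  rectangles \<open>S \<times> C\<close> gives, for each \<open>C\<close>, the desired identity for almost
  every \<open>y\<close>; a countable generator makes the exceptional set independent of
  \<open>C\<close>. Absolute continuity is assumed for the joint laws, so that it is a statement about
  measurable sets.
\<close>
lemma random_map_density:
  fixes \<pi> :: "'y measure" and p :: "'g measure" and M :: "'x measure"
    and \<phi> \<psi> :: "'y \<Rightarrow> 'g \<Rightarrow> 'x"
  assumes "finite_measure \<pi>" "finite_measure p"
    and \<phi>[measurable]: "(\<lambda>(y, g). \<phi> y g) \<in> \<pi> \<Otimes>\<^sub>M p \<rightarrow>\<^sub>M M"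
    and \<psi>[measurable]: "(\<lambda>(y, g). \<psi> y g) \<in> \<pi> \<Otimes>\<^sub>M p \<rightarrow>\<^sub>M M"
    and G: "countable \<G>" "Int_stable \<G>" "space M \<in> \<G>" "\<G> \<subseteq> Pow (space M)"
      "sets M = sigma_sets (space M) \<G>"
    and ac: "\<And>N. N \<in> sets (\<pi> \<Otimes>\<^sub>M M) \<Longrightarrow> AE w in \<pi> \<Otimes>\<^sub>M p. (fst w, \<phi> (fst w) (snd w)) \<notin> N \<Longrightarrow>
      AE w in \<pi> \<Otimes>\<^sub>M p. (fst w, \<psi> (fst w) (snd w)) \<notin> N"
  obtains f :: "'y \<times> 'x \<Rightarrow> real" where "f \<in> borel_measurable (\<pi> \<Otimes>\<^sub>M M)" "\<And>w. 0 \<le> f w"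
    "AE y in \<pi>. distr p M (\<psi> y) = density (distr p M (\<phi> y)) (\<lambda>x. ennreal (f (y, x)))"
proof -
  interpret \<pi>: finite_measure \<pi> by fact
  interpret p: finite_measure p by fact
  interpret \<pi>p: pair_sigma_finite \<pi> p ..
  have fin: "finite_measure (\<pi> \<Otimes>\<^sub>M p)"
    by (rule finite_measure_pair_measure) fact+
  have \<phi>'[measurable]: "(\<lambda>w. \<phi> (fst w) (snd w)) \<in> \<pi> \<Otimes>\<^sub>M p \<rightarrow>\<^sub>M M"
    using \<phi> by (simp add: case_prod_beta')
  have \<psi>'[measurable]: "(\<lambda>w. \<psi> (fst w) (snd w)) \<in> \<pi> \<Otimes>\<^sub>M p \<rightarrow>\<^sub>M M"
    using \<psi> by (simp add: case_prod_beta')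
  define A where "A = distr (\<pi> \<Otimes>\<^sub>M p) (\<pi> \<Otimes>\<^sub>M M) (\<lambda>w. (fst w, \<phi> (fst w) (snd w)))"
  define B where "B = distr (\<pi> \<Otimes>\<^sub>M p) (\<pi> \<Otimes>\<^sub>M M) (\<lambda>w. (fst w, \<psi> (fst w) (snd w)))"
  have sA[measurable_cong]: "sets A = sets (\<pi> \<Otimes>\<^sub>M M)" and sB: "sets B = sets (\<pi> \<Otimes>\<^sub>M M)"
    by (simp_all add: A_def B_def)
  interpret A: finite_measure A
    unfolding A_def by (rule finite_measure.finite_measure_distr[OF fin]) measurable
  interpret B: finite_measure B
    unfolding B_def by (rule finite_measure.finite_measure_distr[OF fin]) measurable
  have AB: "absolutely_continuous A B"
    unfolding absolutely_continuous_def
  proof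
    fix N assume "N \<in> null_sets A"
    hence N: "N \<in> sets (\<pi> \<Otimes>\<^sub>M M)" "AE w in A. w \<notin> N"
      using AE_not_in[of N A] by (auto simp: sA[symmetric])
    have "AE w in \<pi> \<Otimes>\<^sub>M p. (fst w, \<phi> (fst w) (snd w)) \<notin> N"
      using N(2) unfolding A_def by (rule AE_distrD[rotated]) measurable
    from ac[OF N(1) this] have "AE w in B. w \<notin> N"
      unfolding B_def using N(1) by (subst AE_distr_iff) auto
    thus "N \<in> null_sets B" using N(1) by (subst AE_iff_null_sets) (auto simp: sB)
  qed
  obtain D where D: "D \<in> borel_measurable A" "AE w in A. RN_deriv A B w = ennreal (D w)" "\<And>w. 0 \<le> D w"
    using A.real_RN_deriv[OF B.finite_measure_axioms AB] sA sB by metis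
  have Dm[measurable]: "D \<in> borel_measurable (\<pi> \<Otimes>\<^sub>M M)"
    using D(1) by simp
  have B: "B = density A (\<lambda>w. ennreal (D w))"
    using A.density_RN_deriv[OF AB] sA sB density_cong[of "RN_deriv A B" A "\<lambda>w. ennreal (D w)"] D by simp
  have "AE y in \<pi>. \<forall>C\<in>\<G>. (\<integral>\<^sup>+g. indicator C (\<psi> y g) \<partial>p) =
      (\<integral>\<^sup>+g. ennreal (D (y, \<phi> y g)) * indicator C (\<phi> y g) \<partial>p)"
    unfolding AE_ball_countable[OF G(1)]
  proof
    fix C assume "C \<in> \<G>"
    hence C[measurable]: "C \<in> sets M" using G(5) by auto
    show "AE y in \<pi>. (\<integral>\<^sup>+g. indicator C (\<psi> y g) \<partial>p) =
      (\<integral>\<^sup>+g. ennreal (D (y, \<phi> y g)) * indicator C (\<phi> y g) \<partial>p)" (is "AE y in _. ?a y = ?b y")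
    proof (rule \<pi>.density_unique)
      show a: "?a \<in> borel_measurable \<pi>" and b: "?b \<in> borel_measurable \<pi>"
        by measurable
      show "density \<pi> ?a = density \<pi> ?b"
      proof (rule measure_eqI)
        fix S assume "S \<in> sets (density \<pi> ?a)"
        hence S[measurable]: "S \<in> sets \<pi>" by simp
        have "(\<integral>\<^sup>+y. ?a y * indicator S y \<partial>\<pi>) = (\<integral>\<^sup>+y. \<integral>\<^sup>+g. indicator C (\<psi> y g) * indicator S y \<partial>p \<partial>\<pi>)"
          by (intro nn_integral_cong nn_integral_multc[symmetric]) measurable
        also have "\<dots> = (\<integral>\<^sup>+w. indicator C (\<psi> (fst w) (snd w)) * indicator S (fst w) \<partial>(\<pi> \<Otimes>\<^sub>M p))"
          by (subst p.nn_integral_fst[symmetric]) auto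
        also have "\<dots> = emeasure B (S \<times> C)"
          unfolding B_def
          by (subst nn_integral_indicator[symmetric], simp, subst nn_integral_distr)
             (auto intro!: nn_integral_cong simp: indicator_def)
        also have "\<dots> = (\<integral>\<^sup>+w. ennreal (D w) * indicator (S \<times> C) w \<partial>A)"
          unfolding B by (rule emeasure_density) auto
        also have "\<dots> = (\<integral>\<^sup>+w. ennreal (D (fst w, \<phi> (fst w) (snd w))) * indicator C (\<phi> (fst w) (snd w)) * indicator S (fst w) \<partial>(\<pi> \<Otimes>\<^sub>M p))"
          unfolding A_def
          by (subst nn_integral_distr) (auto intro!: nn_integral_cong simp: indicator_def)
        also have "\<dots> = (\<integral>\<^sup>+y. \<integral>\<^sup>+g. ennreal (D (y, \<phi> y g)) * indicator C (\<phi> y g) * indicator S y \<partial>p \<partial>\<pi>)"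
          by (subst p.nn_integral_fst[symmetric]) auto
        also have "\<dots> = (\<integral>\<^sup>+y. ?b y * indicator S y \<partial>\<pi>)"
          by (intro nn_integral_cong nn_integral_multc) measurable
        finally show "emeasure (density \<pi> ?a) S = emeasure (density \<pi> ?b) S"
          using a b by (simp add: emeasure_density)
      qed simp
    qed
  qed
  with AE_space[of \<pi>] have "AE y in \<pi>. distr p M (\<psi> y) = density (distr p M (\<phi> y)) (\<lambda>x. ennreal (D (y, x)))"
  proof eventually_elim
    case (elim y)
    note True = elim(1)
      have [measurable]: "\<phi> y \<in> p \<rightarrow>\<^sub>M M" "\<psi> y \<in> p \<rightarrow>\<^sub>M M" using True by measurable
      have [measurable]: "(\<lambda>x. D (y, x)) \<in> borel_measurable M" using True by measurable
      show ?case
      proof (rule measure_eqI_generator_eq[OF G(2,4)])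
        fix C assume "C \<in> \<G>"
        moreover from this have [measurable]: "C \<in> sets M" using G(5) by auto
        have "emeasure (distr p M (\<psi> y)) C = (\<integral>\<^sup>+g. indicator C (\<psi> y g) \<partial>p)"
          by (subst nn_integral_indicator[symmetric], simp, subst nn_integral_distr) auto
        moreover have "emeasure (density (distr p M (\<phi> y)) (\<lambda>x. ennreal (D (y, x)))) C =
            (\<integral>\<^sup>+g. ennreal (D (y, \<phi> y g)) * indicator C (\<phi> y g) \<partial>p)"
          by (subst emeasure_density, simp, simp, subst nn_integral_distr) auto
        ultimately show "emeasure (distr p M (\<psi> y)) C =
            emeasure (density (distr p M (\<phi> y)) (\<lambda>x. ennreal (D (y, x)))) C"
          using elim(2) by simp
      next
        interpret F: finite_measure "distr p M (\<psi> y)"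
          by (rule p.finite_measure_distr) measurable
        show "emeasure (distr p M (\<psi> y)) (space M) \<noteq> \<infinity>" for i :: nat
          using F.emeasure_finite by simp
      qed (use G in auto)
  qed
  thus ?thesis using that Dm D(3) by blast
qed


lemma (in sigma_finite_measure) pred_AE:
  assumes [measurable]: "Measurable.pred (N \<Otimes>\<^sub>M M) (\<lambda>w. P (fst w) (snd w))"
  shows "Measurable.pred N (\<lambda>x. AE y in M. P x y)"
proof -
  let ?f = "\<lambda>w. if P (fst w) (snd w) then 0 else (1 :: ennreal)"
  have f[measurable]: "?f \<in> borel_measurable (N \<Otimes>\<^sub>M M)" by measurable
  have "(AE y in M. P x y) \<longleftrightarrow> (\<integral>\<^sup>+y. ?f (x, y) \<partial>M) = 0" if "x \<in> space N" for x
  proof -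
    have "(\<lambda>y. ?f (x, y)) \<in> borel_measurable M"
      by (rule measurable_compose[OF measurable_Pair1'[OF that] f])
    from nn_integral_0_iff_AE[OF this] show ?thesis by simp
  qed
  moreover have "Measurable.pred N (\<lambda>x. (\<integral>\<^sup>+y. ?f (x, y) \<partial>M) = 0)" by measurable
  ultimately show ?thesis by (simp cong: measurable_cong)
qed

text \<open>
  Uniqueness of measures for a generator whose members may have infinite measure: finiteness comes
  from the sets \<open>V n\<close>, which need not belong to the generator.
\<close>
lemma measure_eqI_cuts:
  fixes V :: "nat \<Rightarrow> 'a set"
  assumes sets: "sets N1 = sets M" "sets N2 = sets M"
    and G: "Int_stable \<G>" "space M \<in> \<G>" "\<G> \<subseteq> Pow (space M)" "sets M = sigma_sets (space M) \<G>"
    and V: "\<And>n. V n \<in> sets M" "incseq V" "(\<Union>n. V n) = space M"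
    and fin: "\<And>n. emeasure N2 (V n) \<noteq> \<infinity>"
    and eq: "\<And>C n. C \<in> \<G> \<Longrightarrow> emeasure N1 (C \<inter> V n) = emeasure N2 (C \<inter> V n)"
  shows "N1 = N2"
proof (rule measure_eqI)
  have cut: "emeasure (density N (indicator (V n))) C = emeasure N (C \<inter> V n)"
    if "sets N = sets M" "C \<in> sets M" for N C n
  proof -
    have "emeasure (density N (indicator (V n))) C = (\<integral>\<^sup>+x. indicator (V n) x * indicator C x \<partial>N)"
      using that V(1) by (intro emeasure_density) auto
    also have "\<dots> = (\<integral>\<^sup>+x. indicator (C \<inter> V n) x \<partial>N)"
      by (intro nn_integral_cong) (auto split: split_indicator)
    finally show ?thesis using that V(1) by simp
  qed
  have sp: "space N1 = space M" "space N2 = space M" using sets by (auto dest: sets_eq_imp_space_eq)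
  have dens: "density N1 (indicator (V n)) = density N2 (indicator (V n))" for n
  proof (rule measure_eqI_generator_eq[OF G(1,3), where A = "\<lambda>_. space M"])
    have GM: "\<G> \<subseteq> sets M" using G(4) by auto
    fix C assume "C \<in> \<G>"
    thus "emeasure (density N1 (indicator (V n))) C = emeasure (density N2 (indicator (V n))) C"
      using cut sets eq GM by (metis subsetD)
  next
    have "space M \<inter> V n = V n" using V(1) sets.sets_into_space by blast
    thus "emeasure (density N1 (indicator (V n))) (space M) \<noteq> \<infinity>" for i :: nat
      using cut[OF sets(1), of "space M" n] eq[OF G(2), of n] fin[of n] by simp
  qed (use sets G in auto)
  fix C assume "C \<in> sets N1"
  hence C: "C \<in> sets M" using sets by simp
  have un: "(\<Union>n. C \<inter> V n) = C" using V(3) sets.sets_into_space[OF C] by auto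
  have inc: "incseq (\<lambda>n. C \<inter> V n)" using V(2) by (auto simp: incseq_def)
  have "emeasure N1 C = (SUP n. emeasure N1 (C \<inter> V n))"
    using SUP_emeasure_incseq[of "\<lambda>n. C \<inter> V n" N1] inc C V(1) sets un by (auto simp: image_subset_iff)
  also have "\<dots> = (SUP n. emeasure N2 (C \<inter> V n))"
    using dens cut[OF sets(1) C] cut[OF sets(2) C] by simp
  also have "\<dots> = emeasure N2 C"
    using SUP_emeasure_incseq[of "\<lambda>n. C \<inter> V n" N2] inc C V(1) sets un by (auto simp: image_subset_iff)
  finally show "emeasure N1 C = emeasure N2 C" .
qed (use sets in simp)

section \<open>Invariant densities along orbits\<close>

text \<open>
  The countable generator \<open>\<G>\<close> serves to compare measures that depend on a parameter: the
  exceptional null sets of parameters belonging to its members have a null union.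
\<close>
locale quasi_invariant_action =
  fixes act :: "'g::{topological_group_add, second_countable_topology} \<Rightarrow> 'x \<Rightarrow> 'x"
    and M :: "'x measure" and p :: "'g measure" and \<G> :: "'x set set"
  assumes M_sigma_finite: "sigma_finite_measure M"
    and p_finite: "finite_measure p"
    and sets_p[measurable_cong]: "sets p = sets borel"
    and p_nonzero: "emeasure p UNIV \<noteq> 0"
    and p_null_translate: "\<And>A h. A \<in> null_sets p \<Longrightarrow> (\<lambda>g. g + h) -` A \<in> null_sets p"
    and act_meas: "(\<lambda>(g, x). act g x) \<in> borel \<Otimes>\<^sub>M M \<rightarrow>\<^sub>M M"
    and act_0: "\<And>x. x \<in> space M \<Longrightarrow> act 0 x = x"
    and act_plus: "\<And>g h x. x \<in> space M \<Longrightarrow> act (g + h) x = act g (act h x)"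
    and act_distr: "\<And>g. distr M M (act g) = M"
    and gen: "countable \<G>" "Int_stable \<G>" "space M \<in> \<G>" "\<G> \<subseteq> Pow (space M)"
      "sets M = sigma_sets (space M) \<G>"
begin

sublocale p: finite_measure p by (rule p_finite)
sublocale M: sigma_finite_measure M by (rule M_sigma_finite)
sublocale pM: pair_sigma_finite p M ..
sublocale Mp: pair_sigma_finite M p ..
sublocale pp: pair_sigma_finite p p ..

lemma space_p[simp]: "space p = UNIV"
  using sets_eq_imp_space_eq[OF sets_p] by simp

lemma p_UNIV_less_top: "emeasure p UNIV < \<infinity>"
  using p.emeasure_finite[of UNIV] by (simp add: less_top[symmetric])

lemma ennreal_mult_p_less_top: "ennreal r * emeasure p UNIV < \<infinity>"
  using p_UNIV_less_top by (simp add: ennreal_mult_less_top)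

lemma act_measurable[measurable (raw)]:
  assumes "f \<in> N \<rightarrow>\<^sub>M borel" "u \<in> N \<rightarrow>\<^sub>M M"
  shows "(\<lambda>w. act (f w) (u w)) \<in> N \<rightarrow>\<^sub>M M"
  using measurable_compose[OF measurable_Pair[OF assms] act_meas] by simp

lemma uminus_measurable[measurable (raw)]:
  assumes "f \<in> N \<rightarrow>\<^sub>M (borel :: 'g measure)"
  shows "(\<lambda>w. - f w) \<in> N \<rightarrow>\<^sub>M borel"
  by (rule measurable_compose[OF assms])
     (intro borel_measurable_continuous_onI continuous_on_minus continuous_on_id)

lemma plus_measurable[measurable (raw)]:
  assumes "f \<in> N \<rightarrow>\<^sub>M (borel :: 'g measure)" "u \<in> N \<rightarrow>\<^sub>M borel"
  shows "(\<lambda>w. f w + u w) \<in> N \<rightarrow>\<^sub>M borel"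
proof -
  have "(\<lambda>w::'g \<times> 'g. fst w + snd w) \<in> borel \<rightarrow>\<^sub>M borel"
    by (intro borel_measurable_continuous_onI continuous_on_add continuous_on_fst continuous_on_snd
        continuous_on_id)
  hence "(\<lambda>w::'g \<times> 'g. fst w + snd w) \<in> borel \<Otimes>\<^sub>M borel \<rightarrow>\<^sub>M borel"
    by (simp add: borel_prod)
  from measurable_compose[OF measurable_Pair[OF assms] this] show ?thesis by simp
qed

lemma act_in_space[simp]: "x \<in> space M \<Longrightarrow> act g x \<in> space M"
proof -
  assume "x \<in> space M"
  hence "(\<lambda>_. act g x) \<in> (count_space (UNIV :: unit set)) \<rightarrow>\<^sub>M M" by measurable
  thus ?thesis by (auto simp: measurable_def)
qed

lemma act_inverse[simp]:
  assumes "x \<in> space M"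
  shows "act (- g) (act g x) = x" "act g (act (- g) x) = x"
  using act_plus[OF assms, of "- g" g] act_plus[OF assms, of g "- g"] act_0[OF assms] by simp_all

lemma AE_p_translate:
  assumes "AE g in p. P g"
  shows "AE g in p. P (g + h)"
proof -
  obtain N where N: "N \<in> null_sets p" "{g. \<not> P g} \<subseteq> N"
    using assms by (auto elim!: AE_E simp: null_sets_def)
  show ?thesis
    by (rule AE_I'[OF p_null_translate[OF N(1), of h]]) (use N(2) in auto)
qed

lemma AE_act:
  assumes "AE x in M. P x"
  shows "AE x in M. P (act h x)"
proof (rule AE_distrD[of "act h" M M P])
  show "AE x in distr M M (act h). P x" unfolding act_distr by (rule assms)
qed measurable

lemma nn_integral_act:
  assumes [measurable]: "f \<in> borel_measurable M"
  shows "(\<integral>\<^sup>+x. f (act h x) \<partial>M) = (\<integral>\<^sup>+x. f x \<partial>M)"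
  using nn_integral_distr[of "act h" M M f] by (simp add: act_distr)

definition law :: "'x \<Rightarrow> 'x measure" where
  "law y = distr p M (\<lambda>g. act g y)"

lemma sets_law[simp, measurable_cong]: "sets (law y) = sets M"
  and space_law[simp]: "space (law y) = space M"
  by (simp_all add: law_def)

lemma AE_lawD: "y \<in> space M \<Longrightarrow> AE x in law y. P x \<Longrightarrow> AE g in p. P (act g y)"
  unfolding law_def by (rule AE_distrD[rotated]) measurable

lemma AE_lawI: "y \<in> space M \<Longrightarrow> Measurable.pred M P \<Longrightarrow> AE g in p. P (act g y) \<Longrightarrow> AE x in law y. P x"
  unfolding law_def by (subst AE_distr_iff) (auto simp: pred_def)

lemma finite_measure_law: "y \<in> space M \<Longrightarrow> finite_measure (law y)"
  unfolding law_def by (rule p.finite_measure_distr) measurable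

text \<open>
  Null sets of the laws \<open>P\<^sub>y\<close> are constant along orbits, because \<open>g (h y)\<close>
  is \<open>g y\<close> with \<open>g\<close> translated on the right.
\<close>
lemma AE_law_act:
  assumes y: "y \<in> space M" and P: "Measurable.pred M P" "AE x in law y. P x"
  shows "AE x in law (act h y). P x"
proof (rule AE_lawI[OF _ P(1)])
  show "AE g in p. P (act g (act h y))"
    using AE_p_translate[OF AE_lawD[OF y P(2)], of h] y by (simp add: act_plus)
qed (use y in simp)

lemma law_act_absolutely_continuous:
  assumes "y \<in> space M"
  shows "absolutely_continuous (law y) (law (act h y))"
  unfolding absolutely_continuous_def
proof
  fix N assume N: "N \<in> null_sets (law y)"
  hence [measurable]: "N \<in> sets M" by auto
  have "AE x in law (act h y). x \<notin> N"
    by (rule AE_law_act[OF assms]) (use N AE_not_in in auto)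
  thus "N \<in> null_sets (law (act h y))" by (subst AE_iff_null_sets) auto
qed

text \<open>
  With \<open>x = g y\<close>, the substitution \<open>l = k + g\<close> turns \<open>act l y\<close> into
  \<open>act k x\<close>, and for fixed \<open>g\<close> it preserves null sets in \<open>l\<close>. It is the
  step that allows a function of \<open>(z, x)\<close>, known almost everywhere for independent
  \<open>z\<close> and \<open>x\<close> on the orbit of \<open>y\<close>, to be evaluated at
  \<open>z = k x\<close>.
\<close>
lemma AE_law_shear:
  assumes y: "y \<in> space M"
    and Q[measurable]: "Measurable.pred (M \<Otimes>\<^sub>M M) Q"
    and "AE l in p. AE x in law y. Q (act l y, x)"
  shows "AE k in p. AE x in law y. Q (act k x, x)"
proof -
  note y[measurable]
  have "AE l in p. AE g in p. Q (act l y, act g y)"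
    using assms(3) by eventually_elim (rule AE_lawD[OF y])
  hence "AE g in p. AE l in p. Q (act l y, act g y)"
    by (subst pp.AE_commute) measurable
  hence "AE g in p. AE k in p. Q (act k (act g y), act g y)"
  proof eventually_elim
    case (elim g)
    from AE_p_translate[OF this, of g] show ?case using y by (simp add: act_plus)
  qed
  hence "AE k in p. AE g in p. Q (act k (act g y), act g y)"
    by (subst pp.AE_commute) measurable
  thus ?thesis
    by eventually_elim (rule AE_lawI[OF y]; measurable)
qed

text \<open>
  The derivative \<open>R(z, y; x) = (dP\<^sub>z / dP\<^sub>y)(x)\<close>, written as a function of
  \<open>((z, y), x)\<close>. Its parameter is the pair \<open>(z, y)\<close> of points, distributed as
  \<open>(l y, y)\<close>; with the group element \<open>l\<close> as the parameter, \<open>R\<close> could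
  depend on more than the point \<open>l y\<close>.
\<close>
lemma orbit_density_exists:
  obtains R :: "('x \<times> 'x) \<times> 'x \<Rightarrow> real" where "R \<in> borel_measurable ((M \<Otimes>\<^sub>M M) \<Otimes>\<^sub>M M)" "\<And>w. 0 \<le> R w"
    "AE y in M. AE l in p. law (act l y) = density (law y) (\<lambda>x. ennreal (R ((act l y, y), x)))"
proof -
  obtain w where w[measurable]: "w \<in> borel_measurable M" and wint: "integral\<^sup>N M w \<noteq> \<infinity>"
    and wpos: "\<And>x. x \<in> space M \<Longrightarrow> 0 < w x"
    using M.Ex_finite_integrable_function by auto
  \<comment> \<open>Only the null sets of the law of \<open>(l y, y)\<close> matter, so \<open>M\<close> may be replaced by an
    equivalent finite measure, which makes this law finite.\<close>
  define M' where "M' = density M w"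
  have [measurable_cong, simp]: "sets M' = sets M" "space M' = space M" by (simp_all add: M'_def)
  interpret M': finite_measure M'
  proof
    have "emeasure M' (space M') = integral\<^sup>N M w"
      by (simp add: M'_def emeasure_density cong: nn_integral_cong)
    thus "emeasure M' (space M') \<noteq> \<infinity>" using wint by simp
  qed
  interpret M'p: pair_sigma_finite M' p ..
  define \<pi> where "\<pi> = distr (M' \<Otimes>\<^sub>M p) (M \<Otimes>\<^sub>M M) (\<lambda>v. (act (snd v) (fst v), fst v))"
  have [measurable_cong, simp]: "sets \<pi> = sets (M \<Otimes>\<^sub>M M)" by (simp add: \<pi>_def)
  have spi[simp]: "space \<pi> = space M \<times> space M" by (simp add: \<pi>_def space_pair_measure)
  have "finite_measure (M' \<Otimes>\<^sub>M p)"
    by (rule finite_measure_pair_measure) unfold_locales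
  hence \<pi>: "finite_measure \<pi>"
    unfolding \<pi>_def by (rule finite_measure.finite_measure_distr) measurable
  then interpret \<pi>: finite_measure \<pi> .
  interpret \<pi>p: pair_sigma_finite \<pi> p ..
  have ac: "AE v in \<pi> \<Otimes>\<^sub>M p. (fst v, act (snd v) (fst (fst v))) \<notin> N"
    if N: "N \<in> sets (\<pi> \<Otimes>\<^sub>M M)" "AE v in \<pi> \<Otimes>\<^sub>M p. (fst v, act (snd v) (snd (fst v))) \<notin> N" for N
  proof -
    have [measurable]: "N \<in> sets ((M \<Otimes>\<^sub>M M) \<Otimes>\<^sub>M M)"
      using N(1) by (simp cong: sets_pair_measure_cong)
    have "AE v in \<pi>. AE g in p. (v, act g (snd v)) \<notin> N"
      using \<pi>p.AE_pair[OF N(2)] by simp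
    hence "AE v in M' \<Otimes>\<^sub>M p. AE g in p. ((act (snd v) (fst v), fst v), act g (fst v)) \<notin> N"
      unfolding \<pi>_def by (drule_tac AE_distrD[rotated]) auto
    hence *: "AE v in M' \<Otimes>\<^sub>M p. AE g in p. ((act (snd v) (fst v), fst v), act g (act (snd v) (fst v))) \<notin> N"
      using AE_space[of "M' \<Otimes>\<^sub>M p"]
    proof eventually_elim
      case (elim v)
      hence "fst v \<in> space M" by (auto simp: space_pair_measure)
      with AE_p_translate[OF elim(1), of "snd v"] show ?case by (simp add: act_plus)
    qed
    have "AE v in \<pi>. AE g in p. (v, act g (fst v)) \<notin> N"
    proof -
      have "Measurable.pred (M \<Otimes>\<^sub>M M) (\<lambda>v. AE g in p. (v, act g (fst v)) \<notin> N)"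
        by (rule p.pred_AE) measurable
      thus ?thesis
        using * unfolding \<pi>_def by (subst AE_distr_iff) (auto simp: pred_def)
    qed
    hence "AE v in \<pi>. AE g in p. (fst (v, g), act (snd (v, g)) (fst (fst (v, g)))) \<notin> N"
      by simp
    thus ?thesis by (rule \<pi>p.AE_pair_measure[rotated]) measurable
  qed
  obtain f :: "('x \<times> 'x) \<times> 'x \<Rightarrow> real" where f: "f \<in> borel_measurable (\<pi> \<Otimes>\<^sub>M M)" "\<And>w. 0 \<le> f w"
    "AE v in \<pi>. distr p M (\<lambda>g. act g (fst v)) = density (distr p M (\<lambda>g. act g (snd v))) (\<lambda>x. ennreal (f (v, x)))"
    by (rule random_map_density[OF \<pi> p_finite _ _ gen, of "\<lambda>v g. act g (snd v)" "\<lambda>v g. act g (fst v)"])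
       (use ac in auto)
  have "AE v in M' \<Otimes>\<^sub>M p. law (act (snd v) (fst v)) =
      density (law (fst v)) (\<lambda>x. ennreal (f ((act (snd v) (fst v), fst v), x)))"
    using f(3) unfolding \<pi>_def law_def by (drule_tac AE_distrD[rotated]) auto
  from M'p.AE_pair[OF this] have "AE y in M. AE l in p. law (act l y) =
      density (law y) (\<lambda>x. ennreal (f ((act l y, y), x)))"
    unfolding M'_def using wpos by (subst (asm) AE_density) (auto elim!: AE_mp intro!: AE_I2)
  moreover have "f \<in> borel_measurable ((M \<Otimes>\<^sub>M M) \<Otimes>\<^sub>M M)"
    using f(1) by simp
  ultimately show ?thesis using that f(2) by blast
qed


text \<open>
  The measure \<open>\<theta>(x, y) P(dy)\<close> on the orbit of \<open>x\<close>, where \<open>P\<close> is the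
  law of \<open>g\<^sup>-\<^sup>1 x\<close>. The inverse is forced by the exchange of coordinates: for
  \<open>x = g y\<close> the second coordinate of \<open>(g y, y)\<close> is \<open>g\<^sup>-\<^sup>1 x\<close>.
\<close>
definition orbit_law :: "('x \<times> 'x \<Rightarrow> real) \<Rightarrow> 'x \<Rightarrow> 'x measure" where
  "orbit_law \<theta> x = distr (density p (\<lambda>g. ennreal (\<theta> (x, act (- g) x)))) M (\<lambda>g. act (- g) x)"

lemma sets_orbit_law[simp, measurable_cong]: "sets (orbit_law \<theta> x) = sets M"
  and space_orbit_law[simp]: "space (orbit_law \<theta> x) = space M"
  by (simp_all add: orbit_law_def)

lemma nn_integral_orbit_law:
  assumes \<theta>[measurable]: "\<theta> \<in> borel_measurable (M \<Otimes>\<^sub>M M)"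
    and [measurable]: "x \<in> space M" "f \<in> borel_measurable M"
  shows "(\<integral>\<^sup>+y. f y \<partial>orbit_law \<theta> x) = (\<integral>\<^sup>+g. ennreal (\<theta> (x, act (- g) x)) * f (act (- g) x) \<partial>p)"
  unfolding orbit_law_def
  by (subst nn_integral_distr, measurable, subst nn_integral_density) measurable

context
  fixes R :: "('x \<times> 'x) \<times> 'x \<Rightarrow> real"
  assumes R[measurable]: "R \<in> borel_measurable ((M \<Otimes>\<^sub>M M) \<Otimes>\<^sub>M M)" and R_nonneg: "\<And>w. 0 \<le> R w"
    and R_density: "AE y in M. AE l in p. law (act l y) = density (law y) (\<lambda>x. ennreal (R ((act l y, y), x)))"
begin

text \<open>
  The measure \<open>\<theta>(x, y) P\<^sub>y(dx)\<close> with \<open>\<theta>(x, y) = R(k x, y; x)\<close>.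
  Formally it is \<open>P\<^sub>k\<^sub>x(dx)\<close>, an expression in which \<open>y\<close> no longer
  occurs.
\<close>
definition tilted_law :: "'g \<Rightarrow> 'x \<Rightarrow> 'x measure" where
  "tilted_law k y = density (law y) (\<lambda>x. ennreal (R ((act k x, y), x)))"

text \<open>
  The cocycle identity. Let \<open>c\<close> be the derivative of the law at \<open>h y\<close> with respect to
  the law at \<open>y\<close>. Computing the derivative of the law at \<open>l y\<close> directly and by way of
  \<open>h y\<close> gives \<open>R(l y, y; x) = c(x) R(l y, h y; x)\<close> for almost all \<open>l\<close> and
  \<open>x\<close>, and \<open>AE_law_shear\<close> replaces \<open>l y\<close> by \<open>k x\<close>.
\<close>
lemma tilted_law_pointwise_invariant:
  assumes y[measurable]: "y \<in> space M"
    and 1: "AE l in p. law (act l y) = density (law y) (\<lambda>x. ennreal (R ((act l y, y), x)))"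
    and 2: "AE l in p. law (act l (act h y)) = density (law (act h y)) (\<lambda>x. ennreal (R ((act l (act h y), act h y), x)))"
  shows "AE k in p. tilted_law k (act h y) = tilted_law k y"
proof -
  have hy[measurable]: "act h y \<in> space M" using y by simp
  interpret L: finite_measure "law y" by (rule finite_measure_law[OF y])
  define c where "c = RN_deriv (law y) (law (act h y))"
  have [measurable]: "c \<in> borel_measurable M"
    unfolding c_def using borel_measurable_RN_deriv[of "law y" "law (act h y)"] by simp
  have c: "law (act h y) = density (law y) c"
    unfolding c_def using L.density_RN_deriv[OF law_act_absolutely_continuous[OF y]] by simp
  have "AE l in p. law (act (l + - h) (act h y)) =
      density (law (act h y)) (\<lambda>x. ennreal (R ((act (l + - h) (act h y), act h y), x)))"
    by (rule AE_p_translate[OF 2])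
  hence "AE l in p. law (act l y) = density (law (act h y)) (\<lambda>x. ennreal (R ((act l y, act h y), x)))"
    using y by (simp add: act_plus del: add_uminus_conv_diff)
  with 1 have "AE l in p. AE x in law y. ennreal (R ((act l y, y), x)) = c x * ennreal (R ((act l y, act h y), x))"
  proof eventually_elim
    case (elim l)
    have "density (law y) (\<lambda>x. ennreal (R ((act l y, y), x))) =
        density (law y) (\<lambda>x. c x * ennreal (R ((act l y, act h y), x)))"
      using elim unfolding c by (subst density_density_eq[symmetric]) auto
    thus ?case by (intro L.density_unique) auto
  qed
  hence "AE k in p. AE x in law y. ennreal (R ((act k x, y), x)) = c x * ennreal (R ((act k x, act h y), x))"
    using AE_law_shear[of y "\<lambda>w. ennreal (R ((fst w, y), snd w)) = c (snd w) * ennreal (R ((fst w, act h y), snd w))"]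
    using y by simp
  thus ?thesis
  proof eventually_elim
    case (elim k)
    have "tilted_law k (act h y) = density (law y) (\<lambda>x. c x * ennreal (R ((act k x, act h y), x)))"
      unfolding tilted_law_def c by (subst density_density_eq) auto
    also have "\<dots> = tilted_law k y"
      unfolding tilted_law_def using elim by (intro density_cong) auto
    finally show ?case .
  qed
qed

lemma tilted_law_invariant: "AE y in M. AE k in p. tilted_law k (act h y) = tilted_law k y"
  using R_density AE_act[OF R_density, of h] AE_space[of M]
  by eventually_elim (rule tilted_law_pointwise_invariant)

text \<open>
  Where \<open>R(l y, y; \<cdot>)\<close> vanishes, the law at \<open>l y\<close> has no mass, and this law has
  the same null sets as the law at \<open>y\<close>.
\<close>
lemma R_pos: "AE y in M. AE k in p. AE x in law y. 0 < R ((act k x, y), x)"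
  using R_density AE_space[of M]
proof eventually_elim
  case (elim y)
  note y[measurable] = elim(2)
  from elim(1) have "AE l in p. AE x in law y. 0 < R ((act l y, y), x)"
  proof eventually_elim
    case (elim l)
    have ly[measurable]: "act l y \<in> space M" using y by simp
    have "AE x in law (act l y). 0 < R ((act l y, y), x)"
      unfolding elim by (subst AE_density) auto
    hence "AE x in law (act (- l) (act l y)). 0 < R ((act l y, y), x)"
      by (rule AE_law_act[OF ly, rotated]) measurable
    thus ?case by (simp only: act_inverse(1)[OF y])
  qed
  thus ?case using AE_law_shear[OF y, of "\<lambda>w. 0 < R ((fst w, y), snd w)"] by simp
qed

abbreviation orbit_measure :: "'g \<Rightarrow> 'x \<Rightarrow> 'x measure" where
  "orbit_measure k \<equiv> orbit_law (\<lambda>(x, y). R ((act k x, y), x))"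

lemma nn_integral_orbit_measure:
  assumes [measurable]: "x \<in> space M" "f \<in> borel_measurable M"
  shows "(\<integral>\<^sup>+y. f y \<partial>orbit_measure k x) =
    (\<integral>\<^sup>+g. ennreal (R ((act k x, act (- g) x), x)) * f (act (- g) x) \<partial>p)"
proof -
  have "(\<lambda>(x, y). R ((act k x, y), x)) \<in> borel_measurable (M \<Otimes>\<^sub>M M)" by measurable
  from nn_integral_orbit_law[OF this assms] show ?thesis by simp
qed

lemma nn_integral_tilted_law:
  assumes [measurable]: "y \<in> space M" "f \<in> borel_measurable M"
  shows "(\<integral>\<^sup>+x. f x \<partial>tilted_law k y) =
    (\<integral>\<^sup>+g. ennreal (R ((act k (act g y), y), act g y)) * f (act g y) \<partial>p)"
  unfolding tilted_law_def law_def
  by (subst nn_integral_density, measurable, subst nn_integral_distr) measurable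

text \<open>
  The exchange of coordinates. For fixed \<open>g\<close>, invariance of \<open>M\<close> permits the
  substitution \<open>x = g y\<close>, under which \<open>(x, g\<^sup>-\<^sup>1 x)\<close> becomes
  \<open>(g y, y)\<close>.
\<close>
lemma integral_orbit_measure_eq_tilted_law:
  assumes \<Phi>[measurable]: "\<Phi> \<in> borel_measurable (M \<Otimes>\<^sub>M M)"
  shows "(\<integral>\<^sup>+x. \<integral>\<^sup>+y. \<Phi> (x, y) \<partial>orbit_measure k x \<partial>M) = (\<integral>\<^sup>+y. \<integral>\<^sup>+x. \<Phi> (x, y) \<partial>tilted_law k y \<partial>M)"
proof -
  let ?F = "\<lambda>x y. ennreal (R ((act k x, y), x)) * \<Phi> (x, y)"
  have "(\<integral>\<^sup>+x. \<integral>\<^sup>+y. \<Phi> (x, y) \<partial>orbit_measure k x \<partial>M) = (\<integral>\<^sup>+x. \<integral>\<^sup>+g. ?F x (act (- g) x) \<partial>p \<partial>M)"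
    by (intro nn_integral_cong nn_integral_orbit_measure) measurable
  also have "\<dots> = (\<integral>\<^sup>+g. \<integral>\<^sup>+x. ?F x (act (- g) x) \<partial>M \<partial>p)"
    by (rule pM.Fubini') measurable
  also have "\<dots> = (\<integral>\<^sup>+g. \<integral>\<^sup>+y. ?F (act g y) y \<partial>M \<partial>p)"
  proof (rule nn_integral_cong)
    fix g
    have "(\<integral>\<^sup>+x. ?F x (act (- g) x) \<partial>M) = (\<integral>\<^sup>+y. ?F (act g y) (act (- g) (act g y)) \<partial>M)"
      by (rule nn_integral_act[symmetric]) measurable
    also have "\<dots> = (\<integral>\<^sup>+y. ?F (act g y) y \<partial>M)"
      by (intro nn_integral_cong) simp
    finally show "(\<integral>\<^sup>+x. ?F x (act (- g) x) \<partial>M) = (\<integral>\<^sup>+y. ?F (act g y) y \<partial>M)" .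
  qed
  also have "\<dots> = (\<integral>\<^sup>+y. \<integral>\<^sup>+g. ?F (act g y) y \<partial>p \<partial>M)"
    by (rule Mp.Fubini') measurable
  also have "\<dots> = (\<integral>\<^sup>+y. \<integral>\<^sup>+x. \<Phi> (x, y) \<partial>tilted_law k y \<partial>M)"
    by (intro nn_integral_cong nn_integral_tilted_law[symmetric]) measurable
  finally show ?thesis .
qed

text \<open>
  After the exchange of coordinates, \<open>h\<close> acts on the outer variable \<open>y\<close>. The inner
  measure may be taken at \<open>h y\<close> instead of \<open>y\<close>, and then invariance of
  \<open>M\<close> removes \<open>h\<close>. Integrating over \<open>k\<close> as well avoids choosing
  \<open>k\<close> before \<open>h\<close>, although the exceptional set of \<open>k\<close> depends on
  \<open>h\<close> and \<open>y\<close>.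
\<close>
lemma integrated_orbit_measure_invariant:
  assumes \<Phi>[measurable]: "\<Phi> \<in> borel_measurable ((p \<Otimes>\<^sub>M M) \<Otimes>\<^sub>M M)"
  shows "(\<integral>\<^sup>+k. \<integral>\<^sup>+x. \<integral>\<^sup>+y. \<Phi> ((k, x), act h y) \<partial>orbit_measure k x \<partial>M \<partial>p) =
    (\<integral>\<^sup>+k. \<integral>\<^sup>+x. \<integral>\<^sup>+y. \<Phi> ((k, x), y) \<partial>orbit_measure k x \<partial>M \<partial>p)"
proof -
  let ?I = "\<lambda>y' y k. \<integral>\<^sup>+x. \<Phi> ((k, x), y') \<partial>tilted_law k y"
  let ?J = "\<lambda>y' y k. \<integral>\<^sup>+g. ennreal (R ((act k (act g y), y), act g y)) * \<Phi> ((k, act g y), y') \<partial>p"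
  have IJ: "?I y' y k = ?J y' y k" if [measurable]: "y' \<in> space M" "y \<in> space M" for y' y k
    by (rule nn_integral_tilted_law) measurable
  have "(\<integral>\<^sup>+k. \<integral>\<^sup>+x. \<integral>\<^sup>+y. \<Phi> ((k, x), act h y) \<partial>orbit_measure k x \<partial>M \<partial>p) =
      (\<integral>\<^sup>+k. \<integral>\<^sup>+y. ?I (act h y) y k \<partial>M \<partial>p)"
  proof (rule nn_integral_cong)
    fix k
    show "(\<integral>\<^sup>+x. \<integral>\<^sup>+y. \<Phi> ((k, x), act h y) \<partial>orbit_measure k x \<partial>M) = (\<integral>\<^sup>+y. ?I (act h y) y k \<partial>M)"
      using integral_orbit_measure_eq_tilted_law[of "\<lambda>w. \<Phi> ((k, fst w), act h (snd w))" k] by simp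
  qed
  also have "\<dots> = (\<integral>\<^sup>+k. \<integral>\<^sup>+y. ?J (act h y) y k \<partial>M \<partial>p)"
    by (intro nn_integral_cong IJ) auto
  also have "\<dots> = (\<integral>\<^sup>+y. \<integral>\<^sup>+k. ?J (act h y) y k \<partial>p \<partial>M)"
    by (rule Mp.Fubini') measurable
  also have "\<dots> = (\<integral>\<^sup>+y. \<integral>\<^sup>+k. ?I (act h y) y k \<partial>p \<partial>M)"
    by (intro nn_integral_cong IJ[symmetric]) auto
  also have "\<dots> = (\<integral>\<^sup>+y. \<integral>\<^sup>+k. ?I (act h y) (act h y) k \<partial>p \<partial>M)"
  proof (rule nn_integral_cong_AE)
    show "AE y in M. (\<integral>\<^sup>+k. ?I (act h y) y k \<partial>p) = (\<integral>\<^sup>+k. ?I (act h y) (act h y) k \<partial>p)"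
      using tilted_law_invariant[of h]
    proof eventually_elim
      case (elim y)
      show ?case by (rule nn_integral_cong_AE) (use elim in eventually_elim, simp)
    qed
  qed
  also have "\<dots> = (\<integral>\<^sup>+y. \<integral>\<^sup>+k. ?J (act h y) (act h y) k \<partial>p \<partial>M)"
    by (intro nn_integral_cong IJ) auto
  also have "\<dots> = (\<integral>\<^sup>+y. \<integral>\<^sup>+k. ?J y y k \<partial>p \<partial>M)"
    by (rule nn_integral_act) measurable
  also have "\<dots> = (\<integral>\<^sup>+k. \<integral>\<^sup>+y. ?J y y k \<partial>M \<partial>p)"
    by (rule pM.Fubini') measurable
  also have "\<dots> = (\<integral>\<^sup>+k. \<integral>\<^sup>+y. ?I y y k \<partial>M \<partial>p)"
    by (intro nn_integral_cong IJ[symmetric]) auto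
  also have "\<dots> = (\<integral>\<^sup>+k. \<integral>\<^sup>+x. \<integral>\<^sup>+y. \<Phi> ((k, x), y) \<partial>orbit_measure k x \<partial>M \<partial>p)"
  proof (rule nn_integral_cong)
    fix k
    show "(\<integral>\<^sup>+y. ?I y y k \<partial>M) = (\<integral>\<^sup>+x. \<integral>\<^sup>+y. \<Phi> ((k, x), y) \<partial>orbit_measure k x \<partial>M)"
      using integral_orbit_measure_eq_tilted_law[of "\<lambda>w. \<Phi> ((k, fst w), snd w)" k] by simp
  qed
  finally show ?thesis .
qed


text \<open>
  The integrated identity holds for all test functions of \<open>(k, x)\<close>, so the integrands agree
  almost everywhere.
\<close>
lemma AE_orbit_measure_invariant:
  assumes \<Psi>[measurable]: "\<Psi> \<in> borel_measurable ((p \<Otimes>\<^sub>M M) \<Otimes>\<^sub>M M)"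
  shows "AE w in p \<Otimes>\<^sub>M M. (\<integral>\<^sup>+y. \<Psi> (w, act h y) \<partial>orbit_measure (fst w) (snd w)) =
    (\<integral>\<^sup>+y. \<Psi> (w, y) \<partial>orbit_measure (fst w) (snd w))"
proof -
  let ?D = "\<lambda>w g. ennreal (R ((act (fst w) (snd w), act (- g) (snd w)), snd w))"
  define \<alpha> where "\<alpha> h' w = (\<integral>\<^sup>+g. ?D w g * \<Psi> (w, act h' (act (- g) (snd w))) \<partial>p)" for h' w
  have \<alpha>[measurable]: "\<alpha> h' \<in> borel_measurable (p \<Otimes>\<^sub>M M)" for h'
    unfolding \<alpha>_def by measurable
  have \<alpha>_eq: "\<alpha> h' w = (\<integral>\<^sup>+y. \<Psi> (w, act h' y) \<partial>orbit_measure (fst w) (snd w))"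
    if "w \<in> space (p \<Otimes>\<^sub>M M)" for h' w
  proof -
    have [measurable]: "snd w \<in> space M" "w \<in> space (p \<Otimes>\<^sub>M M)" using that by (auto simp: space_pair_measure)
    show ?thesis unfolding \<alpha>_def by (rule nn_integral_orbit_measure[symmetric]) measurable
  qed
  have "density (p \<Otimes>\<^sub>M M) (\<alpha> h) = density (p \<Otimes>\<^sub>M M) (\<alpha> 0)"
  proof (rule measure_eqI)
    fix S assume "S \<in> sets (density (p \<Otimes>\<^sub>M M) (\<alpha> h))"
    hence S[measurable]: "S \<in> sets (p \<Otimes>\<^sub>M M)" by simp
    have *: "(\<integral>\<^sup>+w. \<alpha> h' w * indicator S w \<partial>(p \<Otimes>\<^sub>M M)) =
      (\<integral>\<^sup>+k. \<integral>\<^sup>+x. \<integral>\<^sup>+y. \<Psi> ((k, x), act h' y) * indicator S (k, x) \<partial>orbit_measure k x \<partial>M \<partial>p)" for h'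
    proof -
      have "(\<integral>\<^sup>+w. \<alpha> h' w * indicator S w \<partial>(p \<Otimes>\<^sub>M M)) = (\<integral>\<^sup>+k. \<integral>\<^sup>+x. \<alpha> h' (k, x) * indicator S (k, x) \<partial>M \<partial>p)"
        by (rule M.nn_integral_fst[symmetric]) measurable
      also have "\<dots> = (\<integral>\<^sup>+k. \<integral>\<^sup>+x. \<integral>\<^sup>+y. \<Psi> ((k, x), act h' y) * indicator S (k, x) \<partial>orbit_measure k x \<partial>M \<partial>p)"
      proof (intro nn_integral_cong)
        fix k x assume [measurable]: "x \<in> space M"
        have "\<alpha> h' (k, x) = (\<integral>\<^sup>+y. \<Psi> ((k, x), act h' y) \<partial>orbit_measure k x)"
          using \<alpha>_eq[of "(k, x)" h'] \<open>x \<in> space M\<close> by (simp add: space_pair_measure)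
        thus "\<alpha> h' (k, x) * indicator S (k, x) = (\<integral>\<^sup>+y. \<Psi> ((k, x), act h' y) * indicator S (k, x) \<partial>orbit_measure k x)"
          by (subst nn_integral_multc) auto
      qed
      finally show ?thesis .
    qed
    have inv: "(\<integral>\<^sup>+w. \<alpha> h' w * indicator S w \<partial>(p \<Otimes>\<^sub>M M)) =
      (\<integral>\<^sup>+k. \<integral>\<^sup>+x. \<integral>\<^sup>+y. \<Psi> ((k, x), y) * indicator S (k, x) \<partial>orbit_measure k x \<partial>M \<partial>p)" for h'
      unfolding * using integrated_orbit_measure_invariant[of "\<lambda>v. \<Psi> v * indicator S (fst v)" h'] by simp
    show "emeasure (density (p \<Otimes>\<^sub>M M) (\<alpha> h)) S = emeasure (density (p \<Otimes>\<^sub>M M) (\<alpha> 0)) S"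
      by (simp add: emeasure_density inv)
  qed simp
  hence "AE w in p \<Otimes>\<^sub>M M. \<alpha> h w = \<alpha> 0 w"
    by (intro pM.P.density_unique) auto
  thus ?thesis using AE_space[of "p \<Otimes>\<^sub>M M"]
  proof eventually_elim
    case (elim w)
    have "(\<integral>\<^sup>+y. \<Psi> (w, act 0 y) \<partial>orbit_measure (fst w) (snd w)) = (\<integral>\<^sup>+y. \<Psi> (w, y) \<partial>orbit_measure (fst w) (snd w))"
      by (rule nn_integral_cong) (simp add: act_0)
    thus ?case using elim by (simp add: \<alpha>_eq)
  qed
qed

text \<open>
  If almost every \<open>g\<close> leaves \<open>N\<close> invariant, then by quasi-invariance almost every
  \<open>g\<close> is such that \<open>g\<close> and \<open>g + h\<close> both do, and
  \<open>h = - g + (g + h)\<close>.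
\<close>
lemma invariance_from_conull:
  assumes N: "sets N = sets M" and ae: "AE h in p. distr N M (act h) = N"
  shows "distr N M (act h) = N"
proof -
  have [measurable_cong]: "sets N = sets M" by (rule N)
  have sp: "space N = space M" using N by (rule sets_eq_imp_space_eq)
  have "AE g in p. distr N M (act g) = N \<and> distr N M (act (g + h)) = N"
    using ae AE_p_translate[OF ae, of h] by eventually_elim simp
  moreover have "ae_filter p \<noteq> bot"
    using p_nonzero by (simp add: ae_filter_eq_bot_iff)
  ultimately have "\<exists>g. distr N M (act g) = N \<and> distr N M (act (g + h)) = N"
    by (rule eventually_happens'[rotated])
  then obtain g where g: "distr N M (act g) = N" "distr N M (act (g + h)) = N"
    by (elim exE conjE)
  have comp: "distr (distr N M (act a)) M (act b) = distr N M (act (b + a))" for a b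
    by (subst distr_distr) (auto intro!: distr_cong simp: act_plus sp)
  have id: "distr N M (act 0) = N"
    by (subst distr_cong[OF refl _ act_0, where g = "\<lambda>x. x"]) (auto simp: sp N distr_id2)
  have "distr N M (act (- g)) = distr (distr N M (act g)) M (act (- g))" by (simp add: g)
  also have "\<dots> = N" by (simp add: comp id)
  finally have "N = distr (distr N M (act (g + h))) M (act (- g))" by (simp add: g)
  also have "\<dots> = distr N M (act h)" by (simp add: comp add.assoc[symmetric])
  finally show ?thesis ..
qed

text \<open>
  The test functions \<open>1\<^sub>C 1\<^bsub>{\<theta> \<le> n}\<^esub>\<close> with \<open>C \<in> \<G>\<close>
  form a countable family, and they determine the measure because its restriction to each set
  \<open>{\<theta> \<le> n}\<close> is finite. Hence for almost
  every \<open>(k, x)\<close> the measure is invariant under almost every \<open>h\<close>, and therefore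
  under every \<open>h\<close>.
\<close>
lemma AE_orbit_measure_invariant_all:
  "AE w in p \<Otimes>\<^sub>M M. \<forall>h. distr (orbit_measure (fst w) (snd w)) M (act h) = orbit_measure (fst w) (snd w)"
proof -
  define V where "V n w = {y \<in> space M. R ((act (fst w) (snd w), y), snd w) \<le> real n}" for n w
  let ?S = "\<lambda>w. orbit_measure (fst w) (snd w)"
  let ?E = "\<lambda>h w C n. emeasure (distr (?S w) M (act h)) (C \<inter> V n w) = emeasure (?S w) (C \<inter> V n w)"
  have GM: "C \<in> sets M" if "C \<in> \<G>" for C using that gen(5) by auto
  have Vm: "V n w \<in> sets M" if "w \<in> space (p \<Otimes>\<^sub>M M)" for n w
  proof -
    have [measurable]: "snd w \<in> space M" using that by (auto simp: space_pair_measure)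
    show ?thesis unfolding V_def by measurable
  qed
  have em1: "emeasure (distr (?S w) M (act h)) (C \<inter> V n w) =
      (\<integral>\<^sup>+y. indicator C (act h y) * indicator {..real n} (R ((act (fst w) (snd w), act h y), snd w)) \<partial>?S w)"
    if w: "w \<in> space (p \<Otimes>\<^sub>M M)" and C: "C \<in> \<G>" for h w C n
  proof -
    have [measurable]: "C \<in> sets M" "V n w \<in> sets M"
      using GM[OF C] Vm[OF w] by auto
    have "emeasure (distr (?S w) M (act h)) (C \<inter> V n w) = (\<integral>\<^sup>+y. indicator (C \<inter> V n w) (act h y) \<partial>?S w)"
      by (subst nn_integral_indicator[symmetric], simp, subst nn_integral_distr) auto
    also have "\<dots> = (\<integral>\<^sup>+y. indicator C (act h y) * indicator {..real n} (R ((act (fst w) (snd w), act h y), snd w)) \<partial>?S w)"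
      by (intro nn_integral_cong) (auto simp: indicator_def V_def)
    finally show ?thesis .
  qed
  have em: "emeasure (distr (?S w) M (act h)) (C \<inter> V n w) =
      (\<integral>\<^sup>+g. ennreal (R ((act (fst w) (snd w), act (- g) (snd w)), snd w)) *
        (indicator C (act h (act (- g) (snd w))) *
         indicator {..real n} (R ((act (fst w) (snd w), act h (act (- g) (snd w))), snd w))) \<partial>p)"
    if w: "w \<in> space (p \<Otimes>\<^sub>M M)" and C: "C \<in> \<G>" for h w C n
  proof -
    have [measurable]: "snd w \<in> space M" "C \<in> sets M"
      using w GM[OF C] by (auto simp: space_pair_measure)
    show ?thesis
      unfolding em1[OF w C] by (rule nn_integral_orbit_measure) measurable
  qed
  have em0: "emeasure (?S w) A = emeasure (distr (?S w) M (act 0)) A"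
    if w: "w \<in> space (p \<Otimes>\<^sub>M M)" for w A
    by (subst distr_cong[OF refl _ act_0, where g = "\<lambda>x. x"]) (auto simp: distr_id2)
  have one: "AE w in p \<Otimes>\<^sub>M M. ?E h w C n" if C: "C \<in> \<G>" for h C n
  proof -
    have [measurable]: "C \<in> sets M" using GM[OF C] .
    have "AE w in p \<Otimes>\<^sub>M M.
      (\<integral>\<^sup>+y. indicator C (act h y) * indicator {..real n} (R ((act (fst w) (snd w), act h y), snd w)) \<partial>?S w) =
      (\<integral>\<^sup>+y. indicator C y * indicator {..real n} (R ((act (fst w) (snd w), y), snd w)) \<partial>?S w)"
      using AE_orbit_measure_invariant[of "\<lambda>v. indicator C (snd v) *
        indicator {..real n} (R ((act (fst (fst v)) (snd (fst v)), snd v), snd (fst v)))" h] by simp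
    thus ?thesis using AE_space[of "p \<Otimes>\<^sub>M M"]
    proof eventually_elim
      case (elim w)
      have "(\<integral>\<^sup>+y. indicator C (act 0 y) * indicator {..real n} (R ((act (fst w) (snd w), act 0 y), snd w)) \<partial>?S w) =
        (\<integral>\<^sup>+y. indicator C y * indicator {..real n} (R ((act (fst w) (snd w), y), snd w)) \<partial>?S w)"
        by (intro nn_integral_cong) (simp add: act_0)
      thus ?case unfolding em0[OF elim(2)] em1[OF elim(2) C] elim(1) by simp
    qed
  qed
  have "AE h in p. AE w in p \<Otimes>\<^sub>M M. ?E h w C n" if "C \<in> \<G>" for C n
    using one[OF that] by simp
  hence "AE w in p \<Otimes>\<^sub>M M. AE h in p. ?E h w C n" if C: "C \<in> \<G>" for C n
  proof -
    interpret Q: pair_sigma_finite p "p \<Otimes>\<^sub>M M" ..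
    have [measurable]: "C \<in> sets M" using GM[OF C] .
    have "Measurable.pred (p \<Otimes>\<^sub>M (p \<Otimes>\<^sub>M M)) (\<lambda>v. ?E (fst v) (snd v) C n)"
    proof (subst measurable_cong)
      fix v assume "v \<in> space (p \<Otimes>\<^sub>M (p \<Otimes>\<^sub>M M))"
      hence w: "snd v \<in> space (p \<Otimes>\<^sub>M M)" by (auto simp: space_pair_measure)
      show "?E (fst v) (snd v) C n \<longleftrightarrow>
        (\<lambda>h w. (\<integral>\<^sup>+g. ennreal (R ((act (fst w) (snd w), act (- g) (snd w)), snd w)) *
        (indicator C (act h (act (- g) (snd w))) *
         indicator {..real n} (R ((act (fst w) (snd w), act h (act (- g) (snd w))), snd w))) \<partial>p)) (fst v) (snd v) =
        (\<lambda>h w. (\<integral>\<^sup>+g. ennreal (R ((act (fst w) (snd w), act (- g) (snd w)), snd w)) *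
        (indicator C (act h (act (- g) (snd w))) *
         indicator {..real n} (R ((act (fst w) (snd w), act h (act (- g) (snd w))), snd w))) \<partial>p)) 0 (snd v)"
        unfolding em[OF w C] em0[OF w] ..
    qed measurable
    thus ?thesis
      using \<open>\<And>n C. C \<in> \<G> \<Longrightarrow> AE h in p. AE w in p \<Otimes>\<^sub>M M. ?E h w C n\<close>[OF C, of n]
      by (subst (asm) Q.AE_commute) (auto simp: pred_def)
  qed
  hence "AE w in p \<Otimes>\<^sub>M M. \<forall>C\<in>\<G>. \<forall>n. AE h in p. ?E h w C n"
    by (simp add: AE_ball_countable gen(1) AE_all_countable)
  thus ?thesis using AE_space[of "p \<Otimes>\<^sub>M M"]
  proof eventually_elim
    case (elim w)
    have x[measurable]: "snd w \<in> space M" using elim(2) by (auto simp: space_pair_measure)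
    have "AE h in p. \<forall>C\<in>\<G>. \<forall>n. ?E h w C n"
      using elim(1) by (simp add: AE_ball_countable gen(1) AE_all_countable)
    hence "AE h in p. distr (?S w) M (act h) = ?S w"
    proof eventually_elim
      case (elim h)
      show ?case
      proof (rule measure_eqI_cuts[OF _ _ gen(2,3,4,5), where V = "\<lambda>n. V n w"])
        show "V n w \<in> sets M" for n by (rule Vm) fact
        show "incseq (\<lambda>n. V n w)" by (force simp: incseq_def V_def)
        show "(\<Union>n. V n w) = space M" unfolding V_def using real_arch_simple by auto
        show "emeasure (distr (?S w) M (act h)) (C \<inter> V n w) = emeasure (?S w) (C \<inter> V n w)"
          if "C \<in> \<G>" for C n using elim that by blast
        show "emeasure (?S w) (V n w) \<noteq> \<infinity>" for n
        proof -
          have [measurable]: "V n w \<in> sets M" by (rule Vm) fact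
          have "emeasure (?S w) (V n w) = (\<integral>\<^sup>+y. indicator (V n w) y \<partial>?S w)" by simp
          also have "\<dots> = (\<integral>\<^sup>+g. ennreal (R ((act (fst w) (snd w), act (- g) (snd w)), snd w)) *
              indicator (V n w) (act (- g) (snd w)) \<partial>p)"
            by (rule nn_integral_orbit_measure) measurable
          also have "\<dots> \<le> (\<integral>\<^sup>+g. ennreal (real n) \<partial>p)"
            by (intro nn_integral_mono) (auto simp: indicator_def V_def ennreal_leI)
          also have "\<dots> = ennreal (real n) * emeasure p UNIV" by simp
          also have "\<dots> < \<infinity>" by (rule ennreal_mult_p_less_top)
          finally show ?thesis by simp
        qed
      qed simp_all
    qed
    thus ?case by (intro allI invariance_from_conull sets_orbit_law)
  qed
qed


text \<open>
  Positivity of \<open>R(k x, y; x)\<close> for \<open>x = g y\<close>, rewritten in terms of \<open>x\<close> by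
  invariance of \<open>M\<close>.
\<close>
lemma AE_orbit_measure_nonzero:
  "AE k in p. AE x in M. AE g in p. 0 < R ((act k x, act (- g) x), x)"
proof -
  interpret Mpp: pair_sigma_finite M "p \<Otimes>\<^sub>M p" ..
  let ?P = "\<lambda>y k g. 0 < R ((act k (act g y), y), act g y)"
  have "AE y in M. AE v in p \<Otimes>\<^sub>M p. ?P y (fst v) (snd v)"
    using R_pos AE_space[of M]
  proof eventually_elim
    case (elim y)
    note y[measurable] = elim(2)
    from elim(1) have "AE k in p. AE g in p. ?P y k g"
      by eventually_elim (rule AE_lawD[OF y])
    thus ?case by (subst pp.AE_pair_iff[symmetric]) measurable
  qed
  hence "AE v in p \<Otimes>\<^sub>M p. AE y in M. ?P y (fst v) (snd v)"
    by (subst Mpp.AE_commute[symmetric]) measurable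
  hence "AE v in p \<Otimes>\<^sub>M p. AE x in M. 0 < R ((act (fst v) x, act (- snd v) x), x)"
  proof eventually_elim
    case (elim v)
    from AE_act[OF this, of "- snd v"] AE_space[of M] show ?case
      by eventually_elim simp
  qed
  hence "AE k in p. AE g in p. AE x in M. 0 < R ((act k x, act (- g) x), x)"
    using pp.AE_pair by fastforce
  thus ?thesis
  proof eventually_elim
    case (elim k)
    thus ?case by (subst Mp.AE_commute) measurable
  qed
qed

end

theorem invariant_orbit_density_exists:
  obtains \<theta> :: "'x \<times> 'x \<Rightarrow> real" where "\<theta> \<in> borel_measurable (M \<Otimes>\<^sub>M M)" "\<And>w. 0 \<le> \<theta> w"
    "AE x in M. (\<forall>h. distr (orbit_law \<theta> x) M (act h) = orbit_law \<theta> x) \<and>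
      (AE g in p. 0 < \<theta> (x, act (- g) x))"
proof -
  obtain R :: "('x \<times> 'x) \<times> 'x \<Rightarrow> real" where R: "R \<in> borel_measurable ((M \<Otimes>\<^sub>M M) \<Otimes>\<^sub>M M)" "\<And>w. 0 \<le> R w"
    "AE y in M. AE l in p. law (act l y) = density (law y) (\<lambda>x. ennreal (R ((act l y, y), x)))"
    by (rule orbit_density_exists) (rule that)
  note [measurable] = R(1)
  have "AE k in p. AE x in M. \<forall>h. distr (orbit_measure R k x) M (act h) = orbit_measure R k x"
    using pM.AE_pair[OF AE_orbit_measure_invariant_all[OF R]] by simp
  with AE_orbit_measure_nonzero[OF R]
  have ae: "AE k in p. (AE x in M. AE g in p. 0 < R ((act k x, act (- g) x), x)) \<and>
     (AE x in M. \<forall>h. distr (orbit_measure R k x) M (act h) = orbit_measure R k x)"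
    by eventually_elim simp
  have "ae_filter p \<noteq> bot"
    using p_nonzero by (simp add: ae_filter_eq_bot_iff)
  from eventually_happens'[OF this ae] obtain k where
    k: "AE x in M. AE g in p. 0 < R ((act k x, act (- g) x), x)"
       "AE x in M. \<forall>h. distr (orbit_measure R k x) M (act h) = orbit_measure R k x"
    by (elim exE conjE)
  let ?\<theta> = "\<lambda>(x, y). R ((act k x, y), x)"
  show ?thesis
  proof (rule that[of ?\<theta>])
    show "AE x in M. (\<forall>h. distr (orbit_law ?\<theta> x) M (act h) = orbit_law ?\<theta> x) \<and>
      (AE g in p. 0 < ?\<theta> (x, act (- g) x))"
      using k by eventually_elim simp
    show "?\<theta> \<in> borel_measurable (M \<Otimes>\<^sub>M M)" by measurable
    show "0 \<le> ?\<theta> w" for w using R(2) by (simp add: case_prod_beta')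
  qed
qed

section \<open>Invariant measures on the orbit equivalence relation\<close>

text \<open>
  The set \<open>X0\<close> consists of points at which the orbit law is invariant; the measures on the
  remaining fibers are set to \<open>0\<close>, so that invariance holds on every fiber.
\<close>
context
  fixes \<theta> :: "'x \<times> 'x \<Rightarrow> real" and X0 :: "'x set"
  assumes \<theta>[measurable]: "\<theta> \<in> borel_measurable (M \<Otimes>\<^sub>M M)" and \<theta>_nonneg: "\<And>w. 0 \<le> \<theta> w"
    and X0[measurable]: "X0 \<in> sets M"
    and X0_invariant: "\<And>x h. x \<in> X0 \<Longrightarrow>
      distr (orbit_law \<theta> x) M (act h) = orbit_law \<theta> x"
begin

abbreviation E :: "('x \<times> 'x) measure" where
  "E \<equiv> restrict_space (M \<Otimes>\<^sub>M M) (orbit_rel act M)"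

definition fiber_density :: "'x \<Rightarrow> 'g \<Rightarrow> ennreal" where
  "fiber_density x g = indicator X0 x * ennreal (\<theta> (x, act (- g) x))"

definition fiber_measure :: "'x \<Rightarrow> ('x \<times> 'x) measure" where
  "fiber_measure x = distr (density p (fiber_density x)) E (\<lambda>g. (x, act (- g) x))"

definition total_measure :: "('x \<times> 'x) measure" where
  "total_measure = distr (density (M \<Otimes>\<^sub>M p) (\<lambda>v. fiber_density (fst v) (snd v))) E
     (\<lambda>v. (fst v, act (- snd v) (fst v)))"

lemma orbit_sets_eq: "orbit_sets act M = sets E"
  by (simp add: orbit_sets_def)

lemma orbit_rel_subset: "orbit_rel act M \<subseteq> space M \<times> space M"
  by (auto simp: orbit_rel_def)

lemma space_E: "space E = orbit_rel act M"
  using orbit_rel_subset by (auto simp: space_restrict_space space_pair_measure)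

lemma act_in_orbit_rel: "x \<in> space M \<Longrightarrow> (x, act g x) \<in> orbit_rel act M"
  by (auto simp: orbit_rel_def)

lemma sets_fiber_measure: "sets (fiber_measure x) = sets E"
  and space_fiber_measure: "space (fiber_measure x) = orbit_rel act M"
  by (simp_all add: fiber_measure_def space_E)

lemma sets_total_measure: "sets total_measure = sets E"
  and space_total_measure: "space total_measure = orbit_rel act M"
  by (simp_all add: total_measure_def space_E)

lemma orbit_map_measurable[measurable]:
  "(\<lambda>v. (fst v, act (- snd v) (fst v))) \<in> M \<Otimes>\<^sub>M p \<rightarrow>\<^sub>M E"
  by (rule measurable_restrict_space2) (auto simp: space_pair_measure act_in_orbit_rel)

lemma orbit_map_section_measurable:
  assumes "x \<in> space M"
  shows "(\<lambda>g. (x, act (- g) x)) \<in> p \<rightarrow>\<^sub>M E"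
  using measurable_compose[OF measurable_Pair1'[OF assms] orbit_map_measurable] by simp

lemma fiber_density_measurable[measurable]:
  "(\<lambda>v. fiber_density (fst v) (snd v)) \<in> borel_measurable (M \<Otimes>\<^sub>M p)"
  unfolding fiber_density_def by measurable

lemma fiber_density_section_measurable:
  assumes "x \<in> space M"
  shows "fiber_density x \<in> borel_measurable p"
  using measurable_compose[OF measurable_Pair1'[OF assms] fiber_density_measurable] by simp

lemma act_right_measurable: "(\<lambda>(x, y). (x, act h y)) \<in> E \<rightarrow>\<^sub>M E"
proof (rule measurable_restrict_space2)
  show "(\<lambda>(x, y). (x, act h y)) \<in> space E \<rightarrow> orbit_rel act M"
    unfolding space_E by (auto simp: orbit_rel_def act_plus[symmetric])
  show "(\<lambda>(x, y). (x, act h y)) \<in> E \<rightarrow>\<^sub>M M \<Otimes>\<^sub>M M"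
    by (rule measurable_restrict_space1) measurable
qed

lemma nn_integral_fiber_measure:
  assumes x: "x \<in> space M" and f[measurable]: "f \<in> borel_measurable E"
  shows "(\<integral>\<^sup>+v. f v \<partial>fiber_measure x) = (\<integral>\<^sup>+g. fiber_density x g * f (x, act (- g) x) \<partial>p)"
proof -
  note [measurable] = orbit_map_section_measurable[OF x] fiber_density_section_measurable[OF x]
  have "(\<integral>\<^sup>+v. f v \<partial>fiber_measure x) = (\<integral>\<^sup>+g. f (x, act (- g) x) \<partial>density p (fiber_density x))"
    unfolding fiber_measure_def by (rule nn_integral_distr) measurable
  also have "\<dots> = (\<integral>\<^sup>+g. fiber_density x g * f (x, act (- g) x) \<partial>p)"
    by (rule nn_integral_density, measurable)
  finally show ?thesis .
qed

lemma nn_integral_total_measure: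
  assumes f[measurable]: "f \<in> borel_measurable E"
  shows "(\<integral>\<^sup>+v. f v \<partial>total_measure) = (\<integral>\<^sup>+x. \<integral>\<^sup>+v. f v \<partial>fiber_measure x \<partial>M)"
proof -
  have "(\<integral>\<^sup>+v. f v \<partial>total_measure) =
      (\<integral>\<^sup>+v. f (fst v, act (- snd v) (fst v)) \<partial>density (M \<Otimes>\<^sub>M p) (\<lambda>v. fiber_density (fst v) (snd v)))"
    unfolding total_measure_def by (rule nn_integral_distr) measurable
  also have "\<dots> = (\<integral>\<^sup>+v. fiber_density (fst v) (snd v) * f (fst v, act (- snd v) (fst v)) \<partial>(M \<Otimes>\<^sub>M p))"
    by (rule nn_integral_density) measurable
  also have "\<dots> = (\<integral>\<^sup>+x. \<integral>\<^sup>+g. fiber_density x g * f (x, act (- g) x) \<partial>p \<partial>M)"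
    by (subst p.nn_integral_fst[symmetric]) auto
  also have "\<dots> = (\<integral>\<^sup>+x. \<integral>\<^sup>+v. f v \<partial>fiber_measure x \<partial>M)"
    by (intro nn_integral_cong nn_integral_fiber_measure[symmetric] f)
  finally show ?thesis .
qed

lemma emeasure_total_measure:
  assumes "B \<in> sets E"
  shows "emeasure total_measure B = (\<integral>\<^sup>+x. emeasure (fiber_measure x) B \<partial>M)"
  using nn_integral_total_measure[of "indicator B"] assms
  by (simp add: sets_total_measure sets_fiber_measure)

lemma borel_family_fiber_measure: "borel_family act M fiber_measure"
  unfolding borel_family_def orbit_sets_eq
proof (intro conjI ballI)
  fix B assume B[measurable]: "B \<in> sets E"
  have "(\<lambda>x. \<integral>\<^sup>+g. fiber_density x g * indicator B (x, act (- g) x) \<partial>p) \<in> borel_measurable M"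
  proof (rule p.borel_measurable_nn_integral)
    have "(\<lambda>v. fiber_density (fst v) (snd v) * indicator B (fst v, act (- snd v) (fst v))) \<in> borel_measurable (M \<Otimes>\<^sub>M p)"
      by measurable
    thus "(\<lambda>(x, g). fiber_density x g * indicator B (x, act (- g) x)) \<in> borel_measurable (M \<Otimes>\<^sub>M p)"
      by (simp add: case_prod_beta')
  qed
  moreover have "emeasure (fiber_measure x) B = (\<integral>\<^sup>+g. fiber_density x g * indicator B (x, act (- g) x) \<partial>p)"
    if "x \<in> space M" for x
    using nn_integral_fiber_measure[OF that, of "indicator B"] B by (simp add: sets_fiber_measure)
  ultimately show "(\<lambda>x. emeasure (fiber_measure x) B) \<in> borel_measurable M"
    by (simp cong: measurable_cong)
qed (rule sets_fiber_measure)

text \<open>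
  Integrals of indicators are the form in which invariance passes from the fiber measures to their
  integral over \<open>M\<close>.
\<close>
lemma right_invariantI:
  assumes sets: "sets N = sets E"
    and "\<And>h B. B \<in> sets E \<Longrightarrow> (\<integral>\<^sup>+v. indicator B (fst v, act h (snd v)) \<partial>N) = (\<integral>\<^sup>+v. indicator B v \<partial>N)"
  shows "right_invariant act N"
  unfolding right_invariant_def
proof (intro allI measure_eqI)
  fix h B assume "B \<in> sets (distr N N (\<lambda>(x, y). (x, act h y)))"
  hence B[measurable]: "B \<in> sets E" using sets by simp
  have [measurable_cong]: "sets N = sets E" by (rule sets)
  have T[measurable]: "(\<lambda>(x, y). (x, act h y)) \<in> N \<rightarrow>\<^sub>M N"
    using act_right_measurable[of h] measurable_cong_sets[OF sets sets] by simp
  have "emeasure (distr N N (\<lambda>(x, y). (x, act h y))) B = (\<integral>\<^sup>+v. indicator B v \<partial>distr N N (\<lambda>(x, y). (x, act h y)))"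
    using B sets by simp
  also have "\<dots> = (\<integral>\<^sup>+v. indicator B (case v of (x, y) \<Rightarrow> (x, act h y)) \<partial>N)"
    by (rule nn_integral_distr[OF T]) measurable
  also have "\<dots> = (\<integral>\<^sup>+v. indicator B v \<partial>N)"
    using assms(2)[OF B, of h] by (simp add: case_prod_beta')
  also have "\<dots> = emeasure N B" using B sets by simp
  finally show "emeasure (distr N N (\<lambda>(x, y). (x, act h y))) B = emeasure N B" .
qed simp

lemma indicator_act_right_measurable:
  assumes [measurable]: "B \<in> sets E"
  shows "(\<lambda>v. indicator B (fst v, act h (snd v)) :: ennreal) \<in> borel_measurable E"
  using measurable_compose[OF act_right_measurable[of h], of "indicator B :: _ \<Rightarrow> ennreal" borel]
  by (simp add: case_prod_beta')

text \<open>
  A Borel subset of the orbit relation is the trace of a Borel subset \<open>B'\<close> of the product, and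
  the fiber measure of it is the orbit law of the section of \<open>B'\<close> at \<open>x\<close>.
\<close>
lemma fiber_measure_invariant:
  assumes x[measurable]: "x \<in> space M" and B: "B \<in> sets E"
  shows "(\<integral>\<^sup>+v. indicator B (fst v, act h (snd v)) \<partial>fiber_measure x) = (\<integral>\<^sup>+v. indicator B v \<partial>fiber_measure x)"
proof (cases "x \<in> X0")
  case False
  thus ?thesis
    using nn_integral_fiber_measure[OF x indicator_act_right_measurable[OF B, of h]]
      nn_integral_fiber_measure[OF x, of "indicator B"] B
    by (simp add: fiber_density_def)
next
  case True
  define S where "S = orbit_law \<theta> x"
  obtain B' where [measurable]: "B' \<in> sets (M \<Otimes>\<^sub>M M)" and B': "B = B' \<inter> orbit_rel act M"
    using B by (auto simp: sets_restrict_space)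
  have int: "(\<integral>\<^sup>+y. f y \<partial>S) = (\<integral>\<^sup>+g. ennreal (\<theta> (x, act (- g) x)) * f (act (- g) x) \<partial>p)"
    if [measurable]: "f \<in> borel_measurable M" for f
    unfolding S_def by (rule nn_integral_orbit_law) measurable
  have eq: "(\<integral>\<^sup>+v. indicator B (fst v, act a (snd v)) \<partial>fiber_measure x) = (\<integral>\<^sup>+y. indicator B' (x, act a y) \<partial>S)" for a
  proof -
    have *: "(x, act a (act (- g) x)) \<in> orbit_rel act M" for g
      using act_in_orbit_rel[OF x, of "a + - g"] x by (simp add: act_plus del: add_uminus_conv_diff)
    have "(\<integral>\<^sup>+v. indicator B (fst v, act a (snd v)) \<partial>fiber_measure x) =
        (\<integral>\<^sup>+g. fiber_density x g * indicator B (x, act a (act (- g) x)) \<partial>p)"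
      using nn_integral_fiber_measure[OF x indicator_act_right_measurable[OF B, of a]] by simp
    also have "\<dots> = (\<integral>\<^sup>+g. ennreal (\<theta> (x, act (- g) x)) * indicator B' (x, act a (act (- g) x)) \<partial>p)"
      using True * by (intro nn_integral_cong) (simp add: fiber_density_def B' indicator_def)
    also have "\<dots> = (\<integral>\<^sup>+y. indicator B' (x, act a y) \<partial>S)"
      by (rule int[symmetric]) measurable
    finally show ?thesis .
  qed
  have [measurable_cong]: "sets S = sets M" by (simp add: S_def)
  have spS: "space S = space M" by (simp add: S_def)
  have "(\<integral>\<^sup>+v. indicator B (fst v, act h (snd v)) \<partial>fiber_measure x) = (\<integral>\<^sup>+y. indicator B' (x, y) \<partial>distr S M (act h))"
    unfolding eq by (rule nn_integral_distr[symmetric]) measurable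
  also have "\<dots> = (\<integral>\<^sup>+y. indicator B' (x, y) \<partial>S)"
    using X0_invariant[OF True, of h] by (simp add: S_def)
  also have "\<dots> = (\<integral>\<^sup>+y. indicator B' (x, act 0 y) \<partial>S)"
    by (intro nn_integral_cong) (simp add: act_0 spS)
  also have "\<dots> = (\<integral>\<^sup>+v. indicator B v \<partial>fiber_measure x)"
    unfolding eq[symmetric]
    by (intro nn_integral_cong) (auto simp: space_fiber_measure orbit_rel_def act_0)
  finally show ?thesis .
qed

lemma right_invariant_fiber_measure: "x \<in> space M \<Longrightarrow> right_invariant act (fiber_measure x)"
  by (rule right_invariantI[OF sets_fiber_measure fiber_measure_invariant])

lemma right_invariant_total_measure: "right_invariant act total_measure"
proof (rule right_invariantI[OF sets_total_measure])
  fix h B assume B: "B \<in> sets E"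
  show "(\<integral>\<^sup>+v. indicator B (fst v, act h (snd v)) \<partial>total_measure) = (\<integral>\<^sup>+v. indicator B v \<partial>total_measure)"
    unfolding nn_integral_total_measure[OF indicator_act_right_measurable[OF B]]
      nn_integral_total_measure[OF borel_measurable_indicator[OF B]]
    by (intro nn_integral_cong fiber_measure_invariant B)
qed

text \<open>
  On these sets the density is bounded and the reference measure is finite, uniformly in
  \<open>x\<close>; this yields \<open>\<sigma>\<close>-finiteness on the fibers and of the integral.
\<close>
definition density_cut :: "nat \<Rightarrow> ('x \<times> 'x) set" where
  "density_cut n = {v \<in> space E. \<theta> v \<le> real n}"

lemma density_cut_sets[measurable]: "density_cut n \<in> sets E"
proof -
  have "\<theta> \<in> borel_measurable E" by (rule measurable_restrict_space1[OF \<theta>])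
  thus ?thesis unfolding density_cut_def by measurable
qed

lemma density_cut_UN: "(\<Union>n. density_cut n) = orbit_rel act M"
  unfolding density_cut_def space_E using real_arch_simple by auto

lemma emeasure_fiber_measure_density_cut:
  assumes "x \<in> space M"
  shows "emeasure (fiber_measure x) (density_cut n) \<le> ennreal (real n) * emeasure p UNIV"
proof -
  have "emeasure (fiber_measure x) (density_cut n) =
      (\<integral>\<^sup>+g. fiber_density x g * indicator (density_cut n) (x, act (- g) x) \<partial>p)"
    using nn_integral_fiber_measure[OF assms, of "indicator (density_cut n)"] by (simp add: sets_fiber_measure)
  also have "\<dots> \<le> (\<integral>\<^sup>+g. ennreal (real n) \<partial>p)"
    by (intro nn_integral_mono) (auto simp: fiber_density_def density_cut_def indicator_def ennreal_leI)
  also have "\<dots> = ennreal (real n) * emeasure p UNIV" by simp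
  finally show ?thesis .
qed

lemma sigma_finite_fiber_measure:
  assumes "x \<in> space M"
  shows "sigma_finite_measure (fiber_measure x)"
proof (intro sigma_finite_measure.intro exI[of _ "range density_cut"] conjI ballI)
  fix A assume "A \<in> range density_cut"
  then obtain n where "A = density_cut n" by auto
  moreover have "ennreal (real n) * emeasure p UNIV < \<infinity>"
    by (rule ennreal_mult_p_less_top)
  ultimately show "emeasure (fiber_measure x) A \<noteq> \<infinity>"
    using emeasure_fiber_measure_density_cut[OF assms, of n] by (auto simp: top_unique)
qed (auto simp: sets_fiber_measure density_cut_UN space_fiber_measure)

lemma sigma_finite_total_measure: "sigma_finite_measure total_measure"
proof -
  obtain W :: "nat \<Rightarrow> 'x set" where W: "range W \<subseteq> sets M" "(\<Union>i. W i) = space M" "\<And>i. emeasure M (W i) \<noteq> \<infinity>"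
    using M.sigma_finite by metis
  define A where "A = (\<lambda>(n, i). density_cut n \<inter> (fst -` W i \<inter> space E))"
  have fstE: "fst \<in> E \<rightarrow>\<^sub>M M" by (rule measurable_restrict_space1) measurable
  have W': "fst -` W i \<inter> space E \<in> sets E" for i
    using measurable_sets[OF fstE, of "W i"] W(1) by auto
  show ?thesis
  proof (intro sigma_finite_measure.intro exI[of _ "range A"] conjI ballI)
    show "range A \<subseteq> sets total_measure"
      using W' by (auto simp: A_def sets_total_measure)
    show "\<Union> (range A) = space total_measure"
    proof
      show "space total_measure \<subseteq> \<Union> (range A)"
      proof
        fix v assume v: "v \<in> space total_measure"
        then obtain n where n: "v \<in> density_cut n"
          using density_cut_UN by (auto simp: space_total_measure)
        have "fst v \<in> space M" using v orbit_rel_subset by (auto simp: space_total_measure)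
        then obtain i where "fst v \<in> W i" using W(2) by auto
        hence "v \<in> A (n, i)" using v n by (simp add: A_def space_total_measure space_E)
        thus "v \<in> \<Union> (range A)" by blast
      qed
    qed (auto simp: A_def space_E space_total_measure)
    fix a assume "a \<in> range A"
    then obtain n i where a: "a = density_cut n \<inter> (fst -` W i \<inter> space E)" by (auto simp: A_def)
    have aE: "a \<in> sets E" unfolding a using W' by auto
    have [measurable]: "W i \<in> sets M" using W(1) by auto
    let ?c = "ennreal (real n) * emeasure p UNIV"
    have "emeasure total_measure a = (\<integral>\<^sup>+x. emeasure (fiber_measure x) a \<partial>M)"
      by (rule emeasure_total_measure[OF aE])
    also have "\<dots> \<le> (\<integral>\<^sup>+x. ?c * indicator (W i) x \<partial>M)"
    proof (rule nn_integral_mono)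
      fix x assume x: "x \<in> space M"
      show "emeasure (fiber_measure x) a \<le> ?c * indicator (W i) x"
      proof (cases "x \<in> W i")
        case True
        have "emeasure (fiber_measure x) a \<le> emeasure (fiber_measure x) (density_cut n)"
          unfolding a by (rule emeasure_mono) (auto simp: sets_fiber_measure)
        also have "\<dots> \<le> ?c" by (rule emeasure_fiber_measure_density_cut[OF x])
        finally show ?thesis using True by simp
      next
        case False
        have "emeasure (fiber_measure x) a = (\<integral>\<^sup>+g. fiber_density x g * indicator a (x, act (- g) x) \<partial>p)"
          using nn_integral_fiber_measure[OF x, of "indicator a"] aE by (simp add: sets_fiber_measure)
        also have "\<dots> = 0" using False by (simp add: a)
        finally show ?thesis by simp
      qed
    qed
    also have "\<dots> = ?c * emeasure M (W i)" by (rule nn_integral_cmult_indicator) simp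
    also have "\<dots> < \<infinity>"
      using p_UNIV_less_top W(3)[of i] by (simp add: ennreal_mult_less_top top.not_eq_extremum)
    finally show "emeasure total_measure a \<noteq> \<infinity>" by simp
  qed auto
qed

lemma supported_fiber_measure:
  assumes sing: "\<And>x. x \<in> space M \<Longrightarrow> {x} \<in> sets M"
    and ae: "AE x in M. x \<in> X0 \<and> (AE g in p. 0 < \<theta> (x, act (- g) x))"
  shows "supported_on_left_fibers act M fiber_measure"
proof -
  have L: "left_fiber act M x \<in> sets E" if "x \<in> space M" for x
  proof -
    have "{x} \<times> space M \<in> sets (M \<Otimes>\<^sub>M M)" using sing[OF that] by simp
    moreover have "left_fiber act M x = ({x} \<times> space M) \<inter> orbit_rel act M"
      using orbit_rel_subset by (auto simp: left_fiber_def)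
    ultimately show ?thesis by (auto simp: sets_restrict_space)
  qed
  have in_L: "(x, act (- g) x) \<in> left_fiber act M x" if "x \<in> space M" for x g
    using act_in_orbit_rel[OF that] by (simp add: left_fiber_def)
  show ?thesis
    unfolding supported_on_left_fibers_def
  proof (intro conjI ballI)
    fix x assume x: "x \<in> space M"
    let ?C = "space (fiber_measure x) - left_fiber act M x"
    have "?C = space E - left_fiber act M x" by (simp add: space_fiber_measure space_E)
    hence "?C \<in> sets E" using sets.compl_sets[OF L[OF x]] by simp
    hence "emeasure (fiber_measure x) ?C = (\<integral>\<^sup>+g. fiber_density x g * indicator ?C (x, act (- g) x) \<partial>p)"
      using nn_integral_fiber_measure[OF x, of "indicator ?C"] by (simp add: sets_fiber_measure)
    thus "emeasure (fiber_measure x) ?C = 0" using in_L[OF x] by simp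
  next
    show "AE x in M. emeasure (fiber_measure x) (left_fiber act M x) \<noteq> 0"
      using ae AE_space[of M]
    proof eventually_elim
      case (elim x)
      note x[measurable] = elim(2)
      have "emeasure (fiber_measure x) (left_fiber act M x) =
          (\<integral>\<^sup>+g. fiber_density x g * indicator (left_fiber act M x) (x, act (- g) x) \<partial>p)"
        using nn_integral_fiber_measure[OF x, of "indicator (left_fiber act M x)"] L[OF x]
        by (simp add: sets_fiber_measure)
      also have "\<dots> = (\<integral>\<^sup>+g. ennreal (\<theta> (x, act (- g) x)) \<partial>p)"
        using elim(1) in_L[OF x] by (simp add: fiber_density_def)
      also have "\<dots> \<noteq> 0"
      proof
        assume "(\<integral>\<^sup>+g. ennreal (\<theta> (x, act (- g) x)) \<partial>p) = 0"
        hence "AE g in p. ennreal (\<theta> (x, act (- g) x)) = 0"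
          by (subst (asm) nn_integral_0_iff_AE) measurable
        with conjunct2[OF elim(1)] have "AE g in p. False"
          by eventually_elim simp
        thus False using p_nonzero by (simp add: ae_filter_eq_bot_iff eventually_False)
      qed
      finally show ?case .
    qed
  qed
qed

end

end

section \<open>Standard Borel spaces and the main theorem\<close>

lemma standard_borel_singleton:
  assumes "standard_borel_space M" "x \<in> space M"
  shows "{x} \<in> sets M"
proof -
  obtain T where T: "topspace T = space M" "completely_metrizable_space T"
      "sets M = sigma_sets (space M) {U. openin T U}"
    using assms(1) unfolding standard_borel_space_def by (elim exE conjE)
  have "t1_space T"
    using T(2) by (simp add: completely_metrizable_imp_metrizable_space metrizable_imp_t1_space)
  hence "closedin T {x}" using closedin_t1_singleton assms(2) T(1) by metis
  hence "openin T (space M - {x})" using T(1) by (metis openin_diff openin_topspace)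
  hence "space M - {x} \<in> sets M" unfolding T(3) by (intro sigma_sets.Basic) simp
  from sets.compl_sets[OF this] show ?thesis using assms(2) by (simp add: double_diff)
qed

text \<open>
  Finite intersections of members of a countable base are closed under intersection, and every open
  set is a countable union of members of the base.
\<close>
lemma standard_borel_countable_generator:
  assumes "standard_borel_space M"
  shows "\<exists>\<G>. countable \<G> \<and> Int_stable \<G> \<and> space M \<in> \<G> \<and> \<G> \<subseteq> Pow (space M) \<and>
    sets M = sigma_sets (space M) \<G>"
proof -
  obtain T where T: "topspace T = space M" "second_countable T"
      "sets M = sigma_sets (space M) {U. openin T U}"
    using assms unfolding standard_borel_space_def by (elim exE conjE)
  obtain \<B> where B: "countable \<B>" "\<And>V. V \<in> \<B> \<Longrightarrow> openin T V"
      "\<And>U x. openin T U \<Longrightarrow> x \<in> U \<Longrightarrow> \<exists>V\<in>\<B>. x \<in> V \<and> V \<subseteq> U"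
    using T(2) unfolding second_countable_def by metis
  define m where "m F = space M \<inter> \<Inter>F" for F :: "'a set set"
  define \<G> where "\<G> = m ` {F. finite F \<and> F \<subseteq> \<B>}"
  have mG: "m F \<in> \<G>" if "finite F" "F \<subseteq> \<B>" for F using that by (simp add: \<G>_def)
  have "countable \<G>"
    unfolding \<G>_def by (intro countable_image countable_Collect_finite_subset B(1))
  moreover have "Int_stable \<G>"
  proof (rule Int_stableI)
    fix a b assume "a \<in> \<G>" "b \<in> \<G>"
    then obtain F F' where "finite F" "F \<subseteq> \<B>" "a = m F" "finite F'" "F' \<subseteq> \<B>" "b = m F'"
      by (auto simp: \<G>_def)
    moreover from this have "a \<inter> b = m (F \<union> F')" by (auto simp: m_def)
    ultimately show "a \<inter> b \<in> \<G>" using mG[of "F \<union> F'"] by simp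
  qed
  moreover have "space M \<in> \<G>" using mG[of "{}"] by (simp add: m_def)
  moreover have sub: "\<G> \<subseteq> Pow (space M)" by (auto simp: \<G>_def m_def)
  moreover have "sets M = sigma_sets (space M) \<G>"
    unfolding T(3)
  proof (rule sigma_sets_eqI)
    fix U assume "U \<in> {U. openin T U}"
    hence U: "openin T U" by simp
    define \<V> where "\<V> = {V \<in> \<B>. V \<subseteq> U}"
    have "V \<in> \<G>" if "V \<in> \<V>" for V
    proof -
      have "V \<in> \<B>" using that by (simp add: \<V>_def)
      moreover from this have "V \<subseteq> space M" using B(2) openin_subset T(1) by metis
      ultimately show ?thesis using mG[of "{V}"] by (simp add: m_def Int_absorb1)
    qed
    moreover have "countable \<V>" unfolding \<V>_def using B(1) by simp
    moreover have "U = \<Union>\<V>" unfolding \<V>_def using B(3)[OF U] by auto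
    ultimately show "U \<in> sigma_sets (space M) \<G>"
      using sigma_sets_UNION[of \<V> "space M" \<G>] by (metis sigma_sets.Basic)
  next
    fix a assume "a \<in> \<G>"
    then obtain F where F: "finite F" "F \<subseteq> \<B>" "a = m F" by (auto simp: \<G>_def)
    have "openin T (m F)" using F(1,2)
    proof (induction F)
      case empty
      show ?case using openin_topspace[of T] by (simp add: m_def T(1))
    next
      case (insert V F)
      have "m (insert V F) = V \<inter> m F" by (auto simp: m_def)
      thus ?case using insert B(2)[of V] by (simp add: openin_Int)
    qed
    thus "a \<in> sigma_sets (space M) {U. openin T U}" using F(3) by (intro sigma_sets.Basic) simp
  qed
  ultimately show ?thesis by (intro exI[of _ \<G>] conjI)
qed

theorem corollary1p3:
  fixes act :: "'g::{topological_group_add, t2_space, second_countable_topology} \<Rightarrow> 'x \<Rightarrow> 'x"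
    and \<zeta> :: "'x measure"
  assumes "locally_compact_space (euclidean :: 'g topology)"
    and "standard_borel_space \<zeta>"
    and "sigma_finite_measure \<zeta>"
    and "measure_preserving_action act \<zeta>"
  shows "\<exists>\<kappa> \<nu>.
    borel_family act \<zeta> \<kappa> \<and>
    (\<forall>x\<in>space \<zeta>. right_invariant act (\<kappa> x) \<and> sigma_finite_measure (\<kappa> x)) \<and>
    supported_on_left_fibers act \<zeta> \<kappa> \<and>
    is_integral_of_family act \<zeta> \<kappa> \<nu> \<and>
    right_invariant act \<nu> \<and>
    sigma_finite_measure \<nu>"
proof -
  obtain p :: "'g measure" where p: "sets p = sets borel" "finite_measure p" "emeasure p UNIV \<noteq> 0"
    and p_null: "\<forall>A\<in>null_sets p. \<forall>g. (\<lambda>x. x + g) -` A \<in> null_sets p"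
    using quasi_invariant_finite_measure_exists[OF assms(1)] by (elim exE conjE)
  obtain \<G> where G: "countable \<G>" "Int_stable \<G>" "space \<zeta> \<in> \<G>" "\<G> \<subseteq> Pow (space \<zeta>)"
      "sets \<zeta> = sigma_sets (space \<zeta>) \<G>"
    using standard_borel_countable_generator[OF assms(2)] by (elim exE conjE)
  note act = assms(4)[unfolded measure_preserving_action_def]
  have null: "(\<lambda>g. g + h) -` A \<in> null_sets p" if "A \<in> null_sets p" for A h
    using bspec[OF p_null that] by (rule spec)
  interpret quasi_invariant_action act \<zeta> p \<G>
    using act by (intro quasi_invariant_action.intro assms(3) p null G; simp)
  obtain \<theta> :: "'x \<times> 'x \<Rightarrow> real" where \<theta>: "\<theta> \<in> borel_measurable (\<zeta> \<Otimes>\<^sub>M \<zeta>)" "\<And>w. 0 \<le> \<theta> w"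
    and ae: "AE x in \<zeta>. (\<forall>h. distr (orbit_law \<theta> x) \<zeta> (act h) = orbit_law \<theta> x) \<and>
      (AE g in p. 0 < \<theta> (x, act (- g) x))"
    by (rule invariant_orbit_density_exists) (rule that)
  obtain N where N: "N \<in> null_sets \<zeta>" "{x \<in> space \<zeta>. \<not> ((\<forall>h. distr (orbit_law \<theta> x) \<zeta> (act h) = orbit_law \<theta> x) \<and>
      (AE g in p. 0 < \<theta> (x, act (- g) x)))} \<subseteq> N"
    using ae unfolding eventually_ae_filter by (elim bexE)
  define X0 where "X0 = space \<zeta> - N"
  have X0: "X0 \<in> sets \<zeta>" using N(1) by (auto simp: X0_def)
  have inv: "distr (orbit_law \<theta> x) \<zeta> (act h) = orbit_law \<theta> x" if x: "x \<in> X0" for x h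
  proof (rule ccontr)
    assume "\<not> ?thesis"
    hence "x \<in> N" using x unfolding X0_def by (intro subsetD[OF N(2)]) auto
    thus False using x by (simp add: X0_def)
  qed
  have ae': "AE x in \<zeta>. x \<in> X0 \<and> (AE g in p. 0 < \<theta> (x, act (- g) x))"
    using ae AE_not_in[OF N(1)] AE_space[of \<zeta>] by eventually_elim (simp add: X0_def)
  note A = \<theta> X0 inv
  show ?thesis
  proof (intro exI conjI ballI)
    show "borel_family act \<zeta> (fiber_measure \<theta> X0)" by (rule borel_family_fiber_measure[OF A])
    show "right_invariant act (fiber_measure \<theta> X0 x)" if "x \<in> space \<zeta>" for x
      by (rule right_invariant_fiber_measure[OF A that])
    show "sigma_finite_measure (fiber_measure \<theta> X0 x)" if "x \<in> space \<zeta>" for x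
      by (rule sigma_finite_fiber_measure[OF A that])
    show "supported_on_left_fibers act \<zeta> (fiber_measure \<theta> X0)"
      by (rule supported_fiber_measure[OF A standard_borel_singleton[OF assms(2)] ae'])
    show "is_integral_of_family act \<zeta> (fiber_measure \<theta> X0) (total_measure \<theta> X0)"
      unfolding is_integral_of_family_def orbit_sets_def
      by (intro conjI ballI sets_total_measure[OF A] emeasure_total_measure[OF A])
    show "right_invariant act (total_measure \<theta> X0)" by (rule right_invariant_total_measure[OF A])
    show "sigma_finite_measure (total_measure \<theta> X0)" by (rule sigma_finite_total_measure[OF A])
  qed
qed

end
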